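(* Let $\kappa := 1/\log(10^4)$. Consider a $(1+\beta)$-process on $n$ bins with $\beta \geq 1 - 2^{-0.5 (\log n)^{(k-1)/k}}$ for some integer $1 \leq k \leq \kappa \log \log n$. Then for any $m \geq 1$, \[ \Pr\big[\mathrm{Gap}(m) \leq 1000 \cdot k \cdot (\log n)^{1/k}\big] \geq 1 - n^{-3}. \] In particular, if $\beta \geq 1 - n^{-c_1}$ for some constant $c_1 > 0$, then there is a constant $c_2 = c_2(c_1) > 0$ such that $\mathrm{Gap}(m) \leq c_2 \log \log n$ with high probability.
   Context: Balls are allocated sequentially into $n$ bins, starting from all loads $0$; $x_i^{(t)}$ is the load of bin $i$ after $t$ balls and $\mathrm{Gap}(t) := \max_i x_i^{(t)} - t/n$. In the $(1+\beta)$-process, independently for each ball, with probability $\beta$ two bins are sampled independently and uniformly at random and the ball is placed in the lesser loaded one (ties broken randomly), and with probability $1-\beta$ the ball is placed in a single uniformly random bin. "With high probability" means with probability at least $1 - n^{-c}$ for some constant $c > 0$. As throughout the paper, $n$ is assumed sufficiently large. *)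

theory Defs
  imports "HOL-Probability.Probability"
begin

text \<open>
  The bins are \<open>{..<n}\<close>, and a load vector is a function \<open>nat \<Rightarrow> nat\<close> of which only the
  values on \<open>{..<n}\<close> matter; it is \<open>0\<close> everywhere else. All definitions are meant for \<open>n > 0\<close>.
\<close>

type_synonym loads = "nat \<Rightarrow> nat"

definition one_choice :: "nat \<Rightarrow> nat pmf" where
  "one_choice n = pmf_of_set {..<n}"

text \<open>
  The two samples are drawn with replacement, so they may coincide. A tie is broken by a fair coin:
  \<open>pmf_of_set {i, j}\<close> is uniform on the two bins if \<open>i \<noteq> j\<close> and the point mass at \<open>i\<close> if \<open>i = j\<close>.
\<close>

definition two_choice :: "nat \<Rightarrow> loads \<Rightarrow> nat pmf" where
  "two_choice n x = do {
     i \<leftarrow> pmf_of_set {..<n};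
     j \<leftarrow> pmf_of_set {..<n};
     if x i < x j then return_pmf i
     else if x j < x i then return_pmf j
     else pmf_of_set {i, j}
   }"

definition one_plus_beta_step :: "nat \<Rightarrow> real \<Rightarrow> loads \<Rightarrow> loads pmf" where
  "one_plus_beta_step n \<beta> x = do {
     b \<leftarrow> bernoulli_pmf \<beta>;
     i \<leftarrow> (if b then two_choice n x else one_choice n);
     return_pmf (x(i := x i + 1))
   }"

text \<open>The law of the load vector after \<open>t\<close> balls.\<close>

primrec one_plus_beta :: "nat \<Rightarrow> real \<Rightarrow> nat \<Rightarrow> loads pmf" where
  "one_plus_beta n \<beta> 0 = return_pmf (\<lambda>_. 0)"
| "one_plus_beta n \<beta> (Suc t) = bind_pmf (one_plus_beta n \<beta> t) (one_plus_beta_step n \<beta>)"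

definition gap :: "nat \<Rightarrow> nat \<Rightarrow> loads \<Rightarrow> real" where
  "gap n t x = real (MAX i\<in>{..<n}. x i) - real t / real n"

definition kappa :: real where
  "kappa = 1 / ln (10 ^ 4)"

end

(*
  The gap is first controlled crudely by the potential G = sum_i exp(a y_i) + exp(-a y_i), where y_i is
  the load of bin i minus the average. For two samples, E[min(g_i, g_j)] is the average of g minus half
  of its mean absolute difference, so the drift of G is governed by the mean absolute differences of
  exp(a y) and exp(-a y). If both were small compared with a large G, then most y_i would be large and
  positive, and since the y_i sum to 0 the sum of exp(-a y_i) would dwarf that of exp(a y_i), or vice
  versa. Hence E[G] = O(n), which gives the case k = 1.

  For a small a, G is moreover O(n) with probability 1 - n^-4: while all |y_i| are O(log n), a single
  ball changes G by at most n^(1/4), and exp(t G) with t of order n^(-1/2) has negative drift. So only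
  n / (log n)^2 or so bins exceed the average by a multiple of log log n. Layered induction over the last
  O(n log n) balls finishes the proof (Talwar and Wieder): at the beginning of that window every load is
  below the final average, and a fraction p of bins of height >= h yields a fraction of order
  (log n) (p^2 + (1 - beta) p) of bins of height >= h + 1. This takes O(log log n) squarings and
  O((log n)^(1/k)) contractions by (1 - beta) log n until only O(log n) bins are left, above which at
  most O((log n)^(1/k)) further balls land. As k (log n)^(1/k) is at least a large multiple of
  log log n, the constant 1000 leaves room for all of this.
*)

theory Submission
  imports Defs "HOL-Real_Asymp.Real_Asymp"
begin

section \<open>The law of the chosen bin\<close>

text \<open>Separating the bin from the update makes one step the image of a law on bin indices, so
  one-step expectations become sums over bins.\<close>

definition bin_law :: "nat \<Rightarrow> real \<Rightarrow> loads \<Rightarrow> nat pmf" where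
  "bin_law n \<beta> x = bernoulli_pmf \<beta> \<bind> (\<lambda>b. if b then two_choice n x else one_choice n)"

definition place :: "loads \<Rightarrow> nat \<Rightarrow> loads" where
  "place x i = x(i := x i + 1)"

lemma one_plus_beta_step_eq: "one_plus_beta_step n \<beta> x = map_pmf (place x) (bin_law n \<beta> x)"
  unfolding one_plus_beta_step_def bin_law_def place_def
  by (simp add: map_bind_pmf bind_assoc_pmf map_pmf_def)

lemma expectation_bind_finite:
  fixes h :: "'b \<Rightarrow> real"
  assumes "finite (set_pmf p)" "\<And>x. x \<in> set_pmf p \<Longrightarrow> finite (set_pmf (f x))"
  shows "measure_pmf.expectation (p \<bind> f) h
       = measure_pmf.expectation p (\<lambda>x. measure_pmf.expectation (f x) h)"
proof -
  have "measure_pmf.expectation p (\<lambda>x. measure_pmf.expectation (f x) h)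
      = (\<Sum>x\<in>set_pmf p. pmf p x *\<^sub>R measure_pmf.expectation (f x) h)"
    by (rule integral_measure_pmf) (use assms(1) in auto)
  then show ?thesis
    using pmf_expectation_bind[of "set_pmf p" f p h, OF assms(1) assms(2) order_refl] by simp
qed

lemma expectation_mono_finite:
  fixes f g :: "'a \<Rightarrow> real"
  assumes "finite (set_pmf p)" "\<And>x. x \<in> set_pmf p \<Longrightarrow> f x \<le> g x"
  shows "measure_pmf.expectation p f \<le> measure_pmf.expectation p g"
  using assms by (intro integral_mono_AE) (auto simp: integrable_measure_pmf_finite AE_measure_pmf_iff)

lemma set_pmf_of_bins: "n > 0 \<Longrightarrow> set_pmf (pmf_of_set {..<n}) = {..<n}" for n :: nat
  by (rule set_pmf_of_set) auto

lemma two_choice_support: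
  assumes "n > 0"
  shows "set_pmf (two_choice n x) \<subseteq> {..<n}"
proof -
  have "set_pmf (pmf_of_set {i, j}) = {i, j}" for i j :: nat
    by (rule set_pmf_of_set) auto
  then show ?thesis
    by (auto simp: two_choice_def set_bind_pmf set_pmf_of_bins[OF assms] simp del: set_pmf_of_set pmf_of_set_singleton
        split: if_split_asm)
qed

lemma bin_law_support:
  assumes "n > 0"
  shows "set_pmf (bin_law n \<beta> x) \<subseteq> {..<n}"
proof -
  have "set_pmf (if b then two_choice n x else one_choice n) \<subseteq> {..<n}" for b
    using two_choice_support[OF assms] by (simp add: one_choice_def set_pmf_of_bins[OF assms])
  then show ?thesis unfolding bin_law_def set_bind_pmf by blast
qed

lemma finite_bin_law: "n > 0 \<Longrightarrow> finite (set_pmf (bin_law n \<beta> x))"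
  by (rule finite_subset[OF bin_law_support finite_lessThan])

lemma finite_step: "n > 0 \<Longrightarrow> finite (set_pmf (one_plus_beta_step n \<beta> x))"
  by (simp add: one_plus_beta_step_eq finite_bin_law)

lemma expectation_pmf_of_pair:
  fixes g :: "'a \<Rightarrow> real"
  shows "measure_pmf.expectation (pmf_of_set {i, j}) g = (g i + g j) / 2"
  by (cases "i = j") (simp_all add: integral_pmf_of_set)

lemma expectation_two_choice:
  fixes g :: "nat \<Rightarrow> real"
  assumes "n > 0"
  shows "measure_pmf.expectation (two_choice n x) g
     = (\<Sum>i<n. \<Sum>j<n. if x i < x j then g i else if x j < x i then g j else (g i + g j) / 2) / real n ^ 2"
proof -
  have "measure_pmf.expectation (two_choice n x) g
     = measure_pmf.expectation (pmf_of_set {..<n}) (\<lambda>i. measure_pmf.expectation (pmf_of_set {..<n}) (\<lambda>j.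
        measure_pmf.expectation (if x i < x j then return_pmf i
     else if x j < x i then return_pmf j
     else pmf_of_set {i, j}) g))"
    unfolding two_choice_def using assms
    by (subst expectation_bind_finite, simp add: set_pmf_of_set lessThan_empty_iff,
        simp add: set_pmf_of_set lessThan_empty_iff)
      (subst expectation_bind_finite, auto simp: set_pmf_of_set lessThan_empty_iff)
  also have "\<dots> = (\<Sum>i<n. \<Sum>j<n. if x i < x j then g i else if x j < x i then g j else (g i + g j) / 2) / real n ^ 2"
  proof -
    have "measure_pmf.expectation (if x i < x j then return_pmf i
        else if x j < x i then return_pmf j else pmf_of_set {i, j}) g
        = (if x i < x j then g i else if x j < x i then g j else (g i + g j) / 2)" for i j
      by (simp add: expectation_pmf_of_pair)
    then show ?thesis
      using assms by (simp add: integral_pmf_of_set lessThan_empty_iff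
        power2_eq_square flip: sum_divide_distrib)
  qed
  finally show ?thesis .
qed

lemma expectation_bin_law:
  fixes g :: "nat \<Rightarrow> real"
  assumes "n > 0" "0 \<le> \<beta>" "\<beta> \<le> 1"
  shows "measure_pmf.expectation (bin_law n \<beta> x) g
     = \<beta> * measure_pmf.expectation (two_choice n x) g + (1 - \<beta>) * ((\<Sum>i<n. g i) / n)"
proof -
  have "finite (set_pmf (two_choice n x))" by (rule finite_subset[OF two_choice_support[OF assms(1)] finite_lessThan])
  then show ?thesis unfolding bin_law_def using assms
    by (subst expectation_bind_finite)
     (auto simp: one_choice_def set_pmf_of_set lessThan_empty_iff integral_pmf_of_set)
qed

section \<open>Mean absolute differences and the bias of the chosen bin\<close>

definition mean_diff :: "nat \<Rightarrow> (nat \<Rightarrow> real) \<Rightarrow> real" where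
  "mean_diff n g = (\<Sum>i<n. \<Sum>j<n. \<bar>g i - g j\<bar>) / real n ^ 2"

lemma sum_pairs_avg:
  fixes g :: "nat \<Rightarrow> real"
  shows "(\<Sum>i<n. \<Sum>j<n. (g i + g j) / 2) = real n * (\<Sum>i<n. g i)"
proof -
  have "(\<Sum>i<n. \<Sum>j<n. (g i + g j) / 2) = (\<Sum>i<n. \<Sum>j<n. g i / 2) + (\<Sum>i<n. \<Sum>j<n. g j / 2)"
    by (simp add: add_divide_distrib sum.distrib)
  also have "\<dots> = real n * (\<Sum>i<n. g i)"
    by (simp add: sum_distrib_left[symmetric] sum_divide_distrib[symmetric])
  finally show ?thesis .
qed

text \<open>Two samples return the smaller of \<open>g i\<close> and \<open>g j\<close>, which is
  their mean minus half of their distance. Equal loads force equal values of \<open>g\<close>, as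
  \<open>mono\<close> applies both ways, so the coin toss at ties does not matter.\<close>

lemma expectation_bin_law_mono:
  fixes g :: "nat \<Rightarrow> real"
  assumes "n > 0" "0 \<le> \<beta>" "\<beta> \<le> 1" and mono: "\<And>i j. x i \<le> x j \<Longrightarrow> g i \<le> g j"
  shows "measure_pmf.expectation (bin_law n \<beta> x) g = (\<Sum>i<n. g i) / n - \<beta> / 2 * mean_diff n g"
proof -
  have *: "(if x i < x j then g i else if x j < x i then g j else (g i + g j) / 2)
      = (g i + g j) / 2 - \<bar>g i - g j\<bar> / 2" for i j
    using mono[of i j] mono[of j i] by (auto simp: abs_if field_simps)
  have "measure_pmf.expectation (two_choice n x) g = (\<Sum>i<n. g i) / n - mean_diff n g / 2"
    unfolding expectation_two_choice[OF assms(1)] * sum_subtractf sum_pairs_avg mean_diff_def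
    using assms(1) by (simp add: field_simps power2_eq_square flip: sum_divide_distrib)
  then show ?thesis unfolding expectation_bin_law[OF assms(1-3)]
    by (simp only:) (simp add: field_simps assms(1))
qed

lemma mean_diff_uminus: "mean_diff n (\<lambda>i. - g i) = mean_diff n g"
proof -
  have *: "\<bar>- g i - - g j\<bar> = \<bar>g i - g j\<bar>" for i j by simp
  show ?thesis unfolding mean_diff_def * ..
qed

lemma expectation_bin_law_antimono:
  fixes g :: "nat \<Rightarrow> real"
  assumes "n > 0" "0 \<le> \<beta>" "\<beta> \<le> 1" and "\<And>i j. x i \<le> x j \<Longrightarrow> g j \<le> g i"
  shows "measure_pmf.expectation (bin_law n \<beta> x) g = (\<Sum>i<n. g i) / n + \<beta> / 2 * mean_diff n g"
  using expectation_bin_law_mono[of n \<beta> x "\<lambda>i. - g i"] assms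
  by (simp add: sum_negf mean_diff_uminus)

section \<open>The exponential potential\<close>

text \<open>Triangle inequality: the deviation of \<open>g i\<close> from the mean is the average of
  the differences \<open>g i - g j\<close>. Deviations from the mean are what a counting argument
  can use.\<close>

lemma mean_diff_ge_deviation:
  assumes "n > 0"
  shows "(\<Sum>i<n. \<bar>g i - (\<Sum>j<n. g j) / n\<bar>) / n \<le> mean_diff n g"
proof -
  have "real n * \<bar>g i - (\<Sum>j<n. g j) / n\<bar> \<le> (\<Sum>j<n. \<bar>g i - g j\<bar>)" for i
  proof -
    have "real n * \<bar>g i - (\<Sum>j<n. g j) / n\<bar> = \<bar>real n * (g i - (\<Sum>j<n. g j) / n)\<bar>"
      by (simp add: abs_mult)
    also have "real n * (g i - (\<Sum>j<n. g j) / n) = (\<Sum>j<n. g i - g j)"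
      using assms by (simp add: sum_subtractf field_simps)
    finally show ?thesis using sum_abs[of "\<lambda>j. g i - g j" "{..<n}"] by linarith
  qed
  then have "(\<Sum>i<n. real n * \<bar>g i - (\<Sum>j<n. g j) / n\<bar>) \<le> (\<Sum>i<n. \<Sum>j<n. \<bar>g i - g j\<bar>)"
    by (intro sum_mono) auto
  then have "real n * (\<Sum>i<n. \<bar>g i - (\<Sum>j<n. g j) / n\<bar>) \<le> (\<Sum>i<n. \<Sum>j<n. \<bar>g i - g j\<bar>)"
    by (simp add: sum_distrib_left)
  then show ?thesis
    using assms by (simp add: mean_diff_def field_simps power2_eq_square)
qed

text \<open>If the mean difference were smaller, all but a quarter of the \<open>y i\<close> would be at least \<open>u\<close>, the
  logarithm of half the average of \<open>exp (y i)\<close>. The remaining ones then average at most \<open>- 3 * u\<close>, so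
  \<open>exp (- y i)\<close> would have the larger sum, by the tangent of \<open>exp\<close> at \<open>3 * u\<close>.\<close>
lemma mean_diff_exp_lower:
  fixes y :: "nat \<Rightarrow> real"
  assumes "n > 0" and zero: "(\<Sum>i<n. y i) = 0"
    and dom: "(\<Sum>i<n. exp (- y i)) \<le> (\<Sum>i<n. exp (y i))"
    and large: "6 * real n \<le> (\<Sum>i<n. exp (y i))"
  shows "(\<Sum>i<n. exp (y i)) / (8 * real n) \<le> mean_diff n (\<lambda>i. exp (y i))"
proof (rule ccontr)
  define \<phi> where "\<phi> = (\<Sum>i<n. exp (y i)) / n"
  have \<phi>6: "\<phi> \<ge> 6" using large assms(1) by (simp add: \<phi>_def field_simps)
  assume "\<not> ?thesis"
  then have small: "mean_diff n (\<lambda>i. exp (y i)) < \<phi> / 8"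
    using assms(1) by (simp add: \<phi>_def)
  define Lo where "Lo = {i\<in>{..<n}. exp (y i) < \<phi> / 2}"
  define u where "u = ln (\<phi> / 2)"
  have fin: "finite Lo" and sub: "Lo \<subseteq> {..<n}" by (auto simp: Lo_def)
  \<comment> \<open>Each bin of \<open>Lo\<close> deviates from the mean by at least
    \<open>\<phi> / 2\<close>, and the total deviation is below \<open>n * \<phi> / 8\<close>, so
    \<open>Lo\<close> holds less than a quarter of the bins.\<close>
  have "real (card Lo) * (\<phi> / 2) = (\<Sum>i\<in>Lo. \<phi> / 2)" by simp
  also have "\<dots> \<le> (\<Sum>i\<in>Lo. \<bar>exp (y i) - \<phi>\<bar>)"
    by (intro sum_mono) (auto simp: Lo_def abs_if)
  also have "\<dots> \<le> (\<Sum>i<n. \<bar>exp (y i) - \<phi>\<bar>)"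
    using sub by (intro sum_mono2) auto
  also have "\<dots> \<le> real n * mean_diff n (\<lambda>i. exp (y i))"
    using mean_diff_ge_deviation[OF assms(1), of "\<lambda>i. exp (y i)"] assms(1)
    by (simp add: \<phi>_def field_simps)
  also have "\<dots> < real n * (\<phi> / 8)" using small assms(1) by simp
  finally have "(4 * real (card Lo)) * \<phi> < real n * \<phi>" by (simp add: mult_ac)
  then have card: "4 * real (card Lo) < n"
    using \<phi>6 mult_less_cancel_right_pos[of \<phi> "4 * real (card Lo)" "real n"] by auto
  have "exp (1::real) \<le> 3" using e_less_272 by linarith
  then have u1: "u \<ge> 1"
    using \<phi>6 ln_ge_iff[of "\<phi> / 2" 1] unfolding u_def by linarith
  have "(\<Sum>i\<in>{..<n} - Lo. u) \<le> (\<Sum>i\<in>{..<n} - Lo. y i)"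
  proof (rule sum_mono)
    fix i assume "i \<in> {..<n} - Lo"
    then have "\<phi> / 2 \<le> exp (y i)" by (auto simp: Lo_def)
    then have "ln (\<phi> / 2) \<le> ln (exp (y i))" using \<phi>6 by (subst ln_le_cancel_iff) auto
    then show "u \<le> y i" by (simp add: u_def)
  qed
  moreover have "(\<Sum>i\<in>{..<n} - Lo. y i) = (\<Sum>i\<in>Lo. - y i)"
    using zero sum.subset_diff[OF sub, of y] by (simp add: sum_negf)
  moreover have "real (card ({..<n} - Lo)) = real n - card Lo"
    using card_Diff_subset[OF fin sub] card_mono[OF _ sub] by (simp add: of_nat_diff)
  ultimately have neg: "(real n - card Lo) * u \<le> (\<Sum>i\<in>Lo. - y i)" by (metis sum_constant)
  \<comment> \<open>The last bracket is the sum over \<open>Lo\<close> of the tangent at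
    \<open>3 * u\<close>, without its factor \<open>exp (3 * u)\<close>. As
    \<open>card Lo < n / 4\<close>, it is at least
    \<open>3 / 4 * n * u - (3 * u - 1) * n / 4 = n / 4\<close>.\<close>
  have "exp (3 * u) * (real n / 4) \<le> exp (3 * u) * ((\<Sum>i\<in>Lo. - y i) - (3 * u - 1) * card Lo)"
  proof -
    have "4 * real (card Lo) * u \<le> real n * u" "4 * real (card Lo) * (3 * u - 1) \<le> real n * (3 * u - 1)"
      using card u1 by (auto intro!: mult_right_mono)
    then show ?thesis using neg by (intro mult_left_mono) (auto simp: algebra_simps)
  qed
  also have "(\<Sum>i\<in>Lo. - y i) - (3 * u - 1) * card Lo = (\<Sum>i\<in>Lo. 1 + (- y i - 3 * u))"
    by (simp add: sum.distrib sum_subtractf sum_negf algebra_simps)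
  also have "exp (3 * u) * (\<Sum>i\<in>Lo. 1 + (- y i - 3 * u)) = (\<Sum>i\<in>Lo. exp (3 * u) * (1 + (- y i - 3 * u)))"
    by (rule sum_distrib_left)
  also have "\<dots> \<le> (\<Sum>i\<in>Lo. exp (- y i))"
  proof (rule sum_mono)
    fix i
    have "exp (3 * u) * (1 + (- y i - 3 * u)) \<le> exp (3 * u) * exp (- y i - 3 * u)"
      using exp_ge_add_one_self[of "- y i - 3 * u"] by (intro mult_left_mono) auto
    then show "exp (3 * u) * (1 + (- y i - 3 * u)) \<le> exp (- y i)" by (simp add: exp_add[symmetric])
  qed
  also have "\<dots> \<le> (\<Sum>i<n. exp (- y i))" using sub by (intro sum_mono2) auto
  also have "\<dots> \<le> real n * \<phi>" using dom assms(1) by (simp add: \<phi>_def)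
  finally have "real n * (exp (3 * u) / 4) \<le> real n * \<phi>" by (simp add: mult_ac)
  then have "exp (3 * u) / 4 \<le> \<phi>"
    using assms(1) by (subst (asm) mult_le_cancel_left_pos) auto
  moreover have "exp (3 * u) = (\<phi> / 2) ^ 3"
    using \<phi>6 exp_of_nat_mult[of 3 u] by (simp add: u_def)
  \<comment> \<open>The chain amounts to \<open>\<phi> ^ 3 / 32 \<le> \<phi>\<close>, whereas
    \<open>\<phi> \<ge> 6\<close> gives a square of at least 36.\<close>
  ultimately have "\<phi> * (\<phi> * \<phi>) \<le> \<phi> * 32" by (simp add: power3_eq_cube)
  then have "\<phi> * \<phi> \<le> 32" using \<phi>6 by (subst (asm) mult_le_cancel_left_pos) auto
  moreover have "6 * 6 \<le> \<phi> * \<phi>" using \<phi>6 by (intro mult_mono) auto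
  ultimately show False by simp
qed

text \<open>The average is computed from the loads themselves, so no time index is carried along;
  after \<open>t\<close> balls it is \<open>t / n\<close> by \<open>sum_loads\<close>.\<close>

definition norm_load :: "nat \<Rightarrow> loads \<Rightarrow> nat \<Rightarrow> real" where
  "norm_load n x i = real (x i) - (\<Sum>j<n. real (x j)) / real n"

text \<open>The sign of \<open>s\<close> is left free, so that the same lemmas serve both halves of
  \<open>potential\<close>.\<close>

definition pot :: "real \<Rightarrow> nat \<Rightarrow> loads \<Rightarrow> real" where
  "pot s n x = (\<Sum>i<n. exp (s * norm_load n x i))"

definition potential :: "real \<Rightarrow> nat \<Rightarrow> loads \<Rightarrow> real" where
  "potential \<alpha> n x = pot \<alpha> n x + pot (- \<alpha>) n x"

lemma sum_norm_load: "n > 0 \<Longrightarrow> (\<Sum>i<n. norm_load n x i) = 0"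
  by (simp add: norm_load_def sum_subtractf)

lemma pot_nonneg: "pot s n x \<ge> 0"
  by (simp add: pot_def sum_nonneg)

lemma norm_load_place:
  assumes "i < n"
  shows "norm_load n (place x i) j = norm_load n x j + (if j = i then 1 else 0) - 1 / n"
proof -
  have "(\<Sum>j<n. real (place x i j)) = (\<Sum>j<n. real (x j) + (if j = i then 1 else 0))"
    by (intro sum.cong) (auto simp: place_def)
  then have "(\<Sum>j<n. real (place x i j)) = (\<Sum>j<n. real (x j)) + 1"
    using assms by (simp add: sum.distrib)
  then show ?thesis by (auto simp: norm_load_def place_def field_simps add_divide_distrib)
qed

lemma pot_place:
  assumes "i < n"
  shows "pot s n (place x i) = exp (- s / n) * (pot s n x + (exp s - 1) * exp (s * norm_load n x i))"
proof -
  have "exp (s * norm_load n (place x i) j)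
      = exp (- s / n) * (exp (s * norm_load n x j)
          + (if j = i then (exp s - 1) * exp (s * norm_load n x i) else 0))" for j
    unfolding norm_load_place[OF assms]
    by (auto simp: algebra_simps diff_divide_distrib simp flip: exp_add)
  then show ?thesis
    using assms by (simp add: pot_def sum_distrib_left[symmetric] sum.distrib)
qed

text \<open>For \<open>s \<ge> 0\<close> the weights grow with the load and the rule lowers their
  expectation; for \<open>s < 0\<close> it raises it. The factor \<open>exp s - 1\<close> changes
  sign at the same point, so the mean difference is a loss in both cases.\<close>

lemma expectation_exp_norm_load:
  assumes "n > 0" "0 \<le> \<beta>" "\<beta> \<le> 1"
  shows "(exp s - 1) * measure_pmf.expectation (bin_law n \<beta> x) (\<lambda>i. exp (s * norm_load n x i))
    = (exp s - 1) * pot s n x / n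
      - \<bar>exp s - 1\<bar> * (\<beta> / 2) * mean_diff n (\<lambda>i. exp (s * norm_load n x i))"
proof (cases "s \<ge> 0")
  case True
  have "measure_pmf.expectation (bin_law n \<beta> x) (\<lambda>i. exp (s * norm_load n x i))
    = pot s n x / n - \<beta> / 2 * mean_diff n (\<lambda>i. exp (s * norm_load n x i))"
    unfolding pot_def using True
    by (intro expectation_bin_law_mono assms) (auto intro!: mult_left_mono simp: norm_load_def)
  then show ?thesis using True by (simp only:) (simp add: algebra_simps diff_divide_distrib)
next
  case False
  have "measure_pmf.expectation (bin_law n \<beta> x) (\<lambda>i. exp (s * norm_load n x i))
    = pot s n x / n + \<beta> / 2 * mean_diff n (\<lambda>i. exp (s * norm_load n x i))"
    unfolding pot_def using False
    by (intro expectation_bin_law_antimono assms) (auto intro!: mult_left_mono_neg simp: norm_load_def)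
  then show ?thesis using False by (simp only:) (simp add: algebra_simps diff_divide_distrib)
qed

section \<open>One-step drift of the potential\<close>

lemma exp_le_quadratic:
  fixes s :: real
  assumes "\<bar>s\<bar> \<le> 1"
  shows "exp s \<le> 1 + s + s\<^sup>2"
proof (cases "s \<ge> 0")
  case True
  then show ?thesis using exp_bound assms by auto
next
  case False
  have "1 \<le> (1 - s) * (1 + s + s\<^sup>2)"
  proof -
    have "(1 - s) * (1 + s + s\<^sup>2) = 1 - s ^ 3" by (simp add: algebra_simps power2_eq_square power3_eq_cube)
    moreover have "s ^ 3 \<le> 0" using False by (simp add: power_le_zero_eq)
    ultimately show ?thesis by linarith
  qed
  also have "\<dots> \<le> exp (- s) * (1 + s + s\<^sup>2)"
    using exp_ge_add_one_self[of "- s"] assms by (intro mult_right_mono) (auto simp: power2_eq_square)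
  finally show ?thesis by (simp add: exp_minus field_simps)
qed

lemma integrable_bin_law:
  fixes f :: "nat \<Rightarrow> real"
  shows "n > 0 \<Longrightarrow> integrable (measure_pmf (bin_law n \<beta> x)) f"
  by (rule integrable_measure_pmf_finite[OF finite_bin_law])

lemma expectation_bin_law_cong:
  fixes f g :: "nat \<Rightarrow> real"
  assumes "n > 0" "\<And>i. i < n \<Longrightarrow> f i = g i"
  shows "measure_pmf.expectation (bin_law n \<beta> x) f = measure_pmf.expectation (bin_law n \<beta> x) g"
  using assms bin_law_support[OF assms(1), of \<beta> x] by (intro integral_cong_AE) (auto simp: AE_measure_pmf_iff)

text \<open>The rise of one bin by 1 and the rise of the average by \<open>1 / n\<close> cancel to
  first order in \<open>s\<close>, leaving at most \<open>exp ((exp s - 1 - s) / n)\<close>. So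
  growth of order \<open>s\<^sup>2\<close> stands against a loss of order
  \<open>\<bar>s\<bar>\<close> times the mean difference, and a small \<open>s\<close> favours the
  loss.\<close>

lemma expectation_pot_place:
  assumes "n > 0" "0 \<le> \<beta>" "\<beta> \<le> 1" "\<bar>s\<bar> \<le> 1 / 200"
  shows "measure_pmf.expectation (bin_law n \<beta> x) (\<lambda>i. pot s n (place x i))
    \<le> pot s n x * (1 + 21 / 20 * s\<^sup>2 / n)
      - 99 / 200 * \<bar>s\<bar> * \<beta> * mean_diff n (\<lambda>i. exp (s * norm_load n x i))"
    (is "?E \<le> _ - _ * ?D")
proof -
  have n1: "real n \<ge> 1" using assms(1) by simp
  have D: "?D \<ge> 0" by (simp add: mean_diff_def sum_nonneg)
  have "?E = measure_pmf.expectation (bin_law n \<beta> x)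
      (\<lambda>i. exp (- s / n) * pot s n x + exp (- s / n) * (exp s - 1) * exp (s * norm_load n x i))"
    using assms(1) by (intro expectation_bin_law_cong) (simp_all add: pot_place algebra_simps)
  also have "\<dots> = exp (- s / n) * pot s n x
     + exp (- s / n) * ((exp s - 1) * measure_pmf.expectation (bin_law n \<beta> x) (\<lambda>i. exp (s * norm_load n x i)))"
    using assms(1) by (simp add: integrable_bin_law)
  also have "\<dots> = pot s n x * (exp (- s / n) * (1 + (exp s - 1) / n))
     - exp (- s / n) * \<bar>exp s - 1\<bar> * (\<beta> / 2) * ?D"
    unfolding expectation_exp_norm_load[OF assms(1-3)] by (simp add: algebra_simps add_divide_distrib diff_divide_distrib)
  also have "\<dots> \<le> pot s n x * (1 + 21 / 20 * s\<^sup>2 / n) - 99 / 100 * \<bar>s\<bar> * (\<beta> / 2) * ?D"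
  proof (intro diff_mono mult_left_mono mult_right_mono pot_nonneg D)
    have "exp (- s / n) * (1 + (exp s - 1) / n) \<le> exp (- s / n) * exp ((exp s - 1) / n)"
      by (intro mult_left_mono exp_ge_add_one_self) auto
    also have "\<dots> = exp ((exp s - 1 - s) / n)"
      by (simp add: diff_divide_distrib flip: exp_add)
    also have "\<dots> \<le> exp (s\<^sup>2 / n)"
      using exp_le_quadratic[of s] assms(4) by (auto intro!: divide_right_mono)
    also have "\<dots> \<le> 1 + s\<^sup>2 / n + (s\<^sup>2 / n)\<^sup>2"
    proof (rule exp_le_quadratic)
      have "s\<^sup>2 \<le> 1" using assms(4) by (simp add: abs_square_le_1)
      then show "\<bar>s\<^sup>2 / n\<bar> \<le> 1" using n1 by (simp add: field_simps)
    qed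
    also have "\<dots> \<le> 1 + 21 / 20 * s\<^sup>2 / n"
    proof -
      have "\<bar>s\<bar> ^ 2 \<le> (1 / 200) ^ 2" using assms(4) by (intro power_mono) auto
      then have "s\<^sup>2 \<le> 1 / 20" by (simp add: power2_eq_square)
      then have "s\<^sup>2 / n \<le> 1 / 20" using n1 by (simp add: field_simps)
      then have "(s\<^sup>2 / n) * (s\<^sup>2 / n) \<le> (1 / 20) * (s\<^sup>2 / n)"
        by (intro mult_right_mono) auto
      then show ?thesis by (simp add: power2_eq_square)
    qed
    finally show "exp (- s / n) * (1 + (exp s - 1) / n) \<le> 1 + 21 / 20 * s\<^sup>2 / n" .
  next
    have "s / n \<le> \<bar>s\<bar> / n" by (intro divide_right_mono) auto
    also have "\<bar>s\<bar> / n \<le> \<bar>s\<bar> / 1" using n1 by (intro divide_left_mono) auto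
    finally have "s / n \<le> 1 / 200" using assms(4) by linarith
    then have a: "199 / 200 \<le> exp (- s / n)"
      using exp_ge_add_one_self[of "- s / n"] by simp
    have "\<bar>exp s - 1\<bar> \<ge> \<bar>s\<bar> - s\<^sup>2"
    proof (cases "s \<ge> 0")
      case True
      then show ?thesis using exp_ge_add_one_self[of s] zero_le_power2[of s] by linarith
    next
      case False
      then show ?thesis using exp_le_quadratic[of s] assms(4) by linarith
    qed
    moreover have "s\<^sup>2 \<le> (1 / 200) * \<bar>s\<bar>"
      using assms(4) mult_right_mono[of "\<bar>s\<bar>" "1 / 200" "\<bar>s\<bar>"] by (simp add: power2_eq_square)
    ultimately have b: "199 / 200 * \<bar>s\<bar> \<le> \<bar>exp s - 1\<bar>" by simp
    have "99 / 100 * \<bar>s\<bar> \<le> 199 / 200 * (199 / 200 * \<bar>s\<bar>)" by simp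
    also have "\<dots> \<le> exp (- s / n) * \<bar>exp s - 1\<bar>"
      using a b by (intro mult_mono) auto
    finally show "99 / 100 * \<bar>s\<bar> \<le> exp (- s / n) * \<bar>exp s - 1\<bar>" .
  qed (use assms in auto)
  finally show ?thesis by (simp add: algebra_simps)
qed

text \<open>The larger half carries at least half of the potential, hence at least
  \<open>6 * n\<close>, and \<open>mean_diff_exp_lower\<close> applies to it; the halving turns 8
  into 16.\<close>

lemma mean_diff_potential:
  assumes "n > 0" "12 * real n \<le> potential \<alpha> n x"
  shows "potential \<alpha> n x / (16 * n) \<le>
     mean_diff n (\<lambda>i. exp (\<alpha> * norm_load n x i)) + mean_diff n (\<lambda>i. exp (- \<alpha> * norm_load n x i))"
proof -
  have zero: "(\<Sum>i<n. s * norm_load n x i) = 0" for s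
    using sum_norm_load[OF assms(1), of x] by (simp flip: sum_distrib_left)
  have key: "pot s n x / (8 * n) \<le> mean_diff n (\<lambda>i. exp (s * norm_load n x i))"
    if "pot (- s) n x \<le> pot s n x" "6 * real n \<le> pot s n x" for s
    using mean_diff_exp_lower[OF assms(1) zero[of s]] that by (simp add: pot_def)
  have nn: "mean_diff n g \<ge> 0" for g by (simp add: mean_diff_def sum_nonneg)
  show ?thesis
  proof (cases "pot (- \<alpha>) n x \<le> pot \<alpha> n x")
    case True
    then have "potential \<alpha> n x / (16 * n) \<le> (2 * pot \<alpha> n x) / (16 * n)"
      by (intro divide_right_mono) (simp_all add: potential_def)
    then have "potential \<alpha> n x / (16 * n) \<le> pot \<alpha> n x / (8 * n)" by simp
    also have "\<dots> \<le> mean_diff n (\<lambda>i. exp (\<alpha> * norm_load n x i))"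
      using True assms(2) by (intro key) (auto simp: potential_def)
    finally show ?thesis using nn[of "\<lambda>i. exp (- \<alpha> * norm_load n x i)"] by linarith
  next
    case False
    then have "potential \<alpha> n x / (16 * n) \<le> (2 * pot (- \<alpha>) n x) / (16 * n)"
      by (intro divide_right_mono) (simp_all add: potential_def)
    then have "potential \<alpha> n x / (16 * n) \<le> pot (- \<alpha>) n x / (8 * n)" by simp
    also have "\<dots> \<le> mean_diff n (\<lambda>i. exp (- \<alpha> * norm_load n x i))"
      using False assms(2) by (intro key) (auto simp: potential_def)
    finally show ?thesis using nn[of "\<lambda>i. exp (\<alpha> * norm_load n x i)"] by linarith
  qed
qed

text \<open>The bound \<open>29 / 100\<close> lies just below \<open>1 - 2 powr (- 1 / 2)\<close>,
  the least \<open>\<beta>\<close> allowed for \<open>k = 1\<close>. For a large potential the loss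
  rate \<open>143 / 16000\<close> exceeds the growth rate \<open>21 / 4000\<close> by more than
  \<open>7 / 2000\<close>. Below \<open>12 * n\<close> the growth and the claimed decrease together
  amount to at most \<open>\<alpha>\<close>.\<close>

lemma potential_drift:
  assumes "n > 0" "29 / 100 \<le> \<beta>" "\<beta> \<le> 1" "0 < \<alpha>" "\<alpha> \<le> 1 / 200"
  shows "measure_pmf.expectation (bin_law n \<beta> x) (\<lambda>i. potential \<alpha> n (place x i))
    \<le> potential \<alpha> n x * (1 - 7 / 2000 * \<alpha> / n) + \<alpha>"
proof -
  let ?P = "potential \<alpha> n x"
  let ?D = "mean_diff n (\<lambda>i. exp (\<alpha> * norm_load n x i)) + mean_diff n (\<lambda>i. exp (- \<alpha> * norm_load n x i))"
  have n1: "real n \<ge> 1" using assms(1) by simp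
  have D: "?D \<ge> 0" by (simp add: mean_diff_def sum_nonneg)
  have P: "?P \<ge> 0" by (simp add: potential_def pot_nonneg)
  have "measure_pmf.expectation (bin_law n \<beta> x) (\<lambda>i. potential \<alpha> n (place x i))
    \<le> ?P * (1 + 21 / 20 * \<alpha>\<^sup>2 / n) - 99 / 200 * \<alpha> * \<beta> * ?D"
  proof -
    have "measure_pmf.expectation (bin_law n \<beta> x) (\<lambda>i. potential \<alpha> n (place x i))
      = measure_pmf.expectation (bin_law n \<beta> x) (\<lambda>i. pot \<alpha> n (place x i))
        + measure_pmf.expectation (bin_law n \<beta> x) (\<lambda>i. pot (- \<alpha>) n (place x i))"
      using assms(1) by (simp add: potential_def integrable_bin_law)
    also have "\<dots> \<le> (pot \<alpha> n x * (1 + 21 / 20 * \<alpha>\<^sup>2 / n)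
        - 99 / 200 * \<bar>\<alpha>\<bar> * \<beta> * mean_diff n (\<lambda>i. exp (\<alpha> * norm_load n x i)))
      + (pot (- \<alpha>) n x * (1 + 21 / 20 * (- \<alpha>)\<^sup>2 / n)
        - 99 / 200 * \<bar>- \<alpha>\<bar> * \<beta> * mean_diff n (\<lambda>i. exp (- \<alpha> * norm_load n x i)))"
      using assms by (intro add_mono expectation_pot_place) auto
    also have "\<dots> = ?P * (1 + 21 / 20 * \<alpha>\<^sup>2 / n) - 99 / 200 * \<alpha> * \<beta> * ?D"
      using assms(4) by (simp only: potential_def power2_minus abs_minus_cancel abs_of_pos) (simp add: distrib_left distrib_right add_divide_distrib)
    finally show ?thesis .
  qed
  also have "\<dots> \<le> ?P * (1 + 21 / 4000 * \<alpha> / n) - 143 / 1000 * \<alpha> * ?D"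
  proof (intro diff_mono mult_left_mono mult_right_mono D P)
    show "143 / 1000 * \<alpha> \<le> 99 / 200 * \<alpha> * \<beta>"
      using assms mult_left_mono[of "29 / 100" \<beta> "99 / 200 * \<alpha>"] by simp
    have "\<alpha>\<^sup>2 \<le> 1 / 200 * \<alpha>" using assms by (simp add: power2_eq_square)
    then show "1 + 21 / 20 * \<alpha>\<^sup>2 / n \<le> 1 + 21 / 4000 * \<alpha> / n"
      using n1 by (simp add: field_simps)
  qed
  also have "\<dots> \<le> ?P * (1 - 7 / 2000 * \<alpha> / n) + \<alpha>"
  proof (cases "12 * real n \<le> ?P")
    case True
    define W where "W = \<alpha> * ?P / n"
    have "143 / 1000 * \<alpha> * (?P / (16 * n)) \<le> 143 / 1000 * \<alpha> * ?D"
      using mean_diff_potential[OF assms(1) True] assms by (intro mult_left_mono) auto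
    moreover have "143 / 1000 * \<alpha> * (?P / (16 * n)) = 143 / 16000 * W"
      by (simp add: W_def)
    ultimately have "143 / 16000 * W \<le> 143 / 1000 * \<alpha> * ?D" by simp
    moreover have "0 \<le> W" using assms P by (simp add: W_def)
    moreover have b: "?P * (1 + 21 / 4000 * \<alpha> / n) = ?P + 21 / 4000 * W"
      by (simp add: W_def distrib_left)
    moreover have c: "?P * (1 - 7 / 2000 * \<alpha> / n) = ?P - 7 / 2000 * W"
      by (simp add: W_def right_diff_distrib)
    ultimately show ?thesis unfolding b c using assms(4) by linarith
  next
    case False
    define W where "W = \<alpha> * ?P / n"
    have "?P * (7 / 800 * \<alpha> / n) \<le> (12 * real n) * (7 / 800 * \<alpha> / n)"
      using False assms by (intro mult_right_mono) auto
    also have "\<dots> \<le> \<alpha>" using n1 assms by simp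
    finally have "7 / 800 * W \<le> \<alpha>" by (simp add: W_def mult_ac)
    moreover have "0 \<le> 143 / 1000 * \<alpha> * ?D" by (intro mult_nonneg_nonneg D) (use assms in auto)
    moreover have b: "?P * (1 + 21 / 4000 * \<alpha> / n) = ?P + 21 / 4000 * W"
      by (simp add: W_def distrib_left)
    moreover have c: "?P * (1 - 7 / 2000 * \<alpha> / n) = ?P - 7 / 2000 * W"
      by (simp add: W_def right_diff_distrib)
    ultimately show ?thesis unfolding b c by linarith
  qed
  finally show ?thesis .
qed

section \<open>Concentration of the potential\<close>

text \<open>The recursion is on the first ball, where \<open>one_plus_beta\<close> recurses on the
  last: inductions over the remaining time can then vary the starting loads.\<close>

primrec walk :: "nat \<Rightarrow> real \<Rightarrow> nat \<Rightarrow> loads \<Rightarrow> loads pmf" where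
  "walk n \<beta> 0 x = return_pmf x"
| "walk n \<beta> (Suc t) x = one_plus_beta_step n \<beta> x \<bind> walk n \<beta> t"

lemma one_plus_beta_add: "one_plus_beta n \<beta> (s + t) = one_plus_beta n \<beta> s \<bind> walk n \<beta> t"
proof (induction t arbitrary: s)
  case 0
  have "walk n \<beta> 0 = return_pmf" by (simp add: fun_eq_iff)
  then show ?case by (simp add: bind_return_pmf')
next
  case (Suc t)
  have "one_plus_beta n \<beta> (s + Suc t) = one_plus_beta n \<beta> (Suc s) \<bind> walk n \<beta> t"
    using Suc[of "Suc s"] by simp
  then show ?case by (simp add: bind_assoc_pmf)
qed

lemma finite_one_plus_beta: "n > 0 \<Longrightarrow> finite (set_pmf (one_plus_beta n \<beta> t))"
  by (induction t) (simp_all add: finite_step)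

lemma finite_walk: "n > 0 \<Longrightarrow> finite (set_pmf (walk n \<beta> t x))"
  by (induction t arbitrary: x) (simp_all add: finite_step)

lemma expectation_step:
  "measure_pmf.expectation (one_plus_beta_step n \<beta> x) f
    = measure_pmf.expectation (bin_law n \<beta> x) (\<lambda>i. f (place x i))" for f :: "loads \<Rightarrow> real"
  by (simp add: one_plus_beta_step_eq)

lemma set_step: "n > 0 \<Longrightarrow> y \<in> set_pmf (one_plus_beta_step n \<beta> x) \<Longrightarrow> \<exists>i<n. y = place x i"
  using bin_law_support[of n \<beta> x] by (auto simp: one_plus_beta_step_eq)

lemma prob_bind_finite:
  fixes f :: "'a \<Rightarrow> 'b pmf"
  assumes "finite (set_pmf p)" "\<And>x. x \<in> set_pmf p \<Longrightarrow> finite (set_pmf (f x))"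
  shows "measure_pmf.prob (p \<bind> f) A = measure_pmf.expectation p (\<lambda>x. measure_pmf.prob (f x) A)"
  using expectation_bind_finite[OF assms, where h = "indicator A"] by simp

lemma prob_mono_support:
  assumes "\<And>x. x \<in> set_pmf p \<Longrightarrow> x \<in> A \<Longrightarrow> x \<in> B"
  shows "measure_pmf.prob p A \<le> measure_pmf.prob p B"
  using assms by (intro measure_pmf.finite_measure_mono_AE) (auto simp: AE_measure_pmf_iff)

lemma prob_Markov:
  fixes V :: "'a \<Rightarrow> real"
  assumes "finite (set_pmf p)" "\<And>x. V x \<ge> 0" "c > 0"
  shows "measure_pmf.prob p {x. c \<le> V x} \<le> measure_pmf.expectation p V / c"
proof -
  have "measure_pmf.prob p {x. c \<le> V x} = measure_pmf.expectation p (indicator {x. c \<le> V x})" by simp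
  also have "\<dots> \<le> measure_pmf.expectation p (\<lambda>x. V x / c)"
    using assms by (intro expectation_mono_finite) (auto simp: indicator_def)
  finally show ?thesis by simp
qed

section \<open>The potential in expectation\<close>

lemma potential_zero: "potential \<alpha> n (\<lambda>_. 0) = 2 * n"
  by (simp add: potential_def pot_def norm_load_def)

lemma potential_nonneg: "potential \<alpha> n x \<ge> 0"
  by (simp add: potential_def pot_nonneg)

text \<open>\<open>2000 / 7 * n\<close> is the fixed point of the drift recursion, the same for
  every \<open>\<alpha>\<close>, and the initial value \<open>2 * n\<close> lies below it.\<close>

lemma expectation_potential:
  assumes "n > 0" "29 / 100 \<le> \<beta>" "\<beta> \<le> 1" "0 < \<alpha>" "\<alpha> \<le> 1 / 200"
  shows "measure_pmf.expectation (one_plus_beta n \<beta> t) (potential \<alpha> n) \<le> 2000 / 7 * n"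
proof (induction t)
  case 0
  then show ?case by (simp add: potential_zero)
next
  case (Suc t)
  let ?p = "one_plus_beta n \<beta> t"
  have n1: "real n \<ge> 1" using assms(1) by simp
  have int: "integrable (measure_pmf ?p) f" for f :: "loads \<Rightarrow> real"
    by (rule integrable_measure_pmf_finite[OF finite_one_plus_beta[OF assms(1)]])
  have q: "0 \<le> 1 - 7 / 2000 * \<alpha> / n" using n1 assms(4,5) by (simp add: field_simps)
  have "measure_pmf.expectation (one_plus_beta n \<beta> (Suc t)) (potential \<alpha> n)
     = measure_pmf.expectation ?p (\<lambda>x. measure_pmf.expectation (bin_law n \<beta> x) (\<lambda>i. potential \<alpha> n (place x i)))"
    using assms(1) by (simp add: expectation_bind_finite finite_one_plus_beta finite_step expectation_step)
  also have "\<dots> \<le> measure_pmf.expectation ?p (\<lambda>x. potential \<alpha> n x * (1 - 7 / 2000 * \<alpha> / n) + \<alpha>)"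
    by (intro expectation_mono_finite finite_one_plus_beta potential_drift assms)
  also have "\<dots> = measure_pmf.expectation ?p (potential \<alpha> n) * (1 - 7 / 2000 * \<alpha> / n) + \<alpha>"
    by (simp add: int)
  also have "\<dots> \<le> 2000 / 7 * n * (1 - 7 / 2000 * \<alpha> / n) + \<alpha>"
    using Suc q by (intro add_mono mult_right_mono) auto
  also have "\<dots> = 2000 / 7 * n" using n1 by (simp add: field_simps)
  finally show ?case .
qed

lemma exp_abs_le_potential:
  assumes "i < n" "\<alpha> \<ge> 0"
  shows "exp (\<alpha> * \<bar>norm_load n x i\<bar>) \<le> potential \<alpha> n x"
proof -
  have le: "exp (s * norm_load n x i) \<le> pot s n x" for s
    unfolding pot_def using assms(1) by (intro member_le_sum) auto
  show ?thesis
    using le[of \<alpha>] le[of "- \<alpha>"] pot_nonneg[of \<alpha> n x] pot_nonneg[of "- \<alpha>" n x]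
    by (auto simp: potential_def abs_if)
qed

definition spread :: "nat \<Rightarrow> real \<Rightarrow> loads set" where
  "spread n H = {x. \<exists>i<n. H \<le> \<bar>norm_load n x i\<bar>}"

lemma prob_spread:
  \<comment> \<open>Markov's inequality at \<open>1 / 200\<close>, the largest exponent that
    \<open>potential_drift\<close> admits; a single bin deviating by \<open>H\<close> already forces
    a potential of \<open>exp (H / 200)\<close>.\<close>
  assumes "n > 0" "29 / 100 \<le> \<beta>" "\<beta> \<le> 1"
  shows "measure_pmf.prob (one_plus_beta n \<beta> t) (spread n H) \<le> 2000 / 7 * n * exp (- H / 200)"
proof -
  let ?p = "one_plus_beta n \<beta> t"
  have "measure_pmf.prob ?p (spread n H) \<le> measure_pmf.prob ?p {x. exp (H / 200) \<le> potential (1 / 200) n x}"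
  proof (rule prob_mono_support)
    fix x assume "x \<in> spread n H"
    then obtain i where i: "i < n" "H \<le> \<bar>norm_load n x i\<bar>" by (auto simp: spread_def)
    then have "exp (H / 200) \<le> exp (1 / 200 * \<bar>norm_load n x i\<bar>)" by simp
    also have "\<dots> \<le> potential (1 / 200) n x" using i by (intro exp_abs_le_potential) auto
    finally show "x \<in> {x. exp (H / 200) \<le> potential (1 / 200) n x}" by simp
  qed
  also have "\<dots> \<le> measure_pmf.expectation ?p (potential (1 / 200) n) / exp (H / 200)"
    using assms by (intro prob_Markov finite_one_plus_beta potential_nonneg) auto
  also have "\<dots> \<le> 2000 / 7 * n / exp (H / 200)"
    using assms by (intro divide_right_mono expectation_potential) auto
  finally show ?thesis by (simp add: exp_minus field_simps)
qed

lemma sum_loads: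
  assumes "n > 0" "x \<in> set_pmf (one_plus_beta n \<beta> t)"
  shows "(\<Sum>i<n. real (x i)) = t"
  using assms(2)
proof (induction t arbitrary: x)
  case (Suc t)
  then obtain y where y: "y \<in> set_pmf (one_plus_beta n \<beta> t)" "x \<in> set_pmf (one_plus_beta_step n \<beta> y)"
    by auto
  then obtain i where i: "i < n" "x = place y i" using set_step[OF assms(1)] by blast
  have "(\<Sum>j<n. real (x j)) = (\<Sum>j<n. real (y j) + (if j = i then 1 else 0))"
    unfolding i(2) by (intro sum.cong) (auto simp: place_def)
  then show ?case using i(1) Suc.IH[OF y(1)] by (simp add: sum.distrib)
qed simp

text \<open>Paths that enter \<open>B\<close> are charged to the sum on the right, so the drift condition is only
  needed outside \<open>B\<close>.\<close>
lemma prob_walk_drift: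
  fixes V :: "loads \<Rightarrow> real"
  assumes "n > 0" and nonneg: "\<And>x. V x \<ge> 0" and "c > 0" "b \<ge> 0" "0 \<le> \<rho>" "\<rho> < 1"
    and drift: "\<And>x. x \<notin> B \<Longrightarrow> measure_pmf.expectation (one_plus_beta_step n \<beta> x) V \<le> \<rho> * V x + b"
  shows "measure_pmf.prob (walk n \<beta> t x) {y. c \<le> V y}
     \<le> (\<rho> ^ t * V x + b / (1 - \<rho>)) / c + (\<Sum>j<t. measure_pmf.prob (walk n \<beta> j x) B)"
proof -
  have "measure_pmf.prob (walk n \<beta> t x) {y. c \<le> V y}
     \<le> (\<rho> ^ t * V x + b * (\<Sum>j<t. \<rho> ^ j)) / c + (\<Sum>j<t. measure_pmf.prob (walk n \<beta> j x) B)" for t x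
  proof (induction t arbitrary: x)
    case 0
    show ?case using assms(3) nonneg[of x] by (auto simp: measure_return_pmf indicator_def)
  next
    case (Suc t)
    \<comment> \<open>The summand for \<open>j = 0\<close> is the indicator of \<open>B\<close> at
      the start. It makes the bound trivial inside \<open>B\<close>; outside it vanishes, and the
      other summands are those of the walk after one ball.\<close>
    have shift: "(\<Sum>j<Suc t. measure_pmf.prob (walk n \<beta> j x) B)
      = indicator B x + (\<Sum>j<t. measure_pmf.prob (walk n \<beta> (Suc j) x) B)"
      by (simp add: sum.lessThan_Suc_shift measure_return_pmf del: sum.lessThan_Suc)
    show ?case
    proof (cases "x \<in> B")
      case True
      have "0 \<le> (\<rho> ^ Suc t * V x + b * (\<Sum>j<Suc t. \<rho> ^ j)) / c"
        using assms(3-5) nonneg[of x] by (intro divide_nonneg_pos add_nonneg_nonneg mult_nonneg_nonneg sum_nonneg) auto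
      moreover have "0 \<le> (\<Sum>j<t. measure_pmf.prob (walk n \<beta> (Suc j) x) B)" by (intro sum_nonneg) auto
      ultimately show ?thesis unfolding shift
        using True measure_pmf.prob_le_1[of "walk n \<beta> (Suc t) x" "{y. c \<le> V y}"]
        by (simp only: indicator_simps)
    next
      case False
      let ?p = "one_plus_beta_step n \<beta> x"
      have int: "integrable (measure_pmf ?p) f" for f :: "loads \<Rightarrow> real"
        by (rule integrable_measure_pmf_finite[OF finite_step[OF assms(1)]])
      have "measure_pmf.prob (walk n \<beta> (Suc t) x) {y. c \<le> V y}
         = measure_pmf.expectation ?p (\<lambda>z. measure_pmf.prob (walk n \<beta> t z) {y. c \<le> V y})"
        using assms(1) by (simp add: prob_bind_finite finite_step finite_walk)
      also have "\<dots> \<le> measure_pmf.expectation ?p (\<lambda>z. (\<rho> ^ t * V z + b * (\<Sum>j<t. \<rho> ^ j)) / c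
           + (\<Sum>j<t. measure_pmf.prob (walk n \<beta> j z) B))"
        by (intro expectation_mono_finite finite_step assms Suc.IH)
      also have "\<dots> = (\<rho> ^ t * measure_pmf.expectation ?p V + b * (\<Sum>j<t. \<rho> ^ j)) / c
           + (\<Sum>j<t. measure_pmf.expectation ?p (\<lambda>z. measure_pmf.prob (walk n \<beta> j z) B))"
        by (simp add: int)
      also have "\<dots> \<le> (\<rho> ^ t * (\<rho> * V x + b) + b * (\<Sum>j<t. \<rho> ^ j)) / c
           + (\<Sum>j<t. measure_pmf.expectation ?p (\<lambda>z. measure_pmf.prob (walk n \<beta> j z) B))"
        using assms(3,4,5) by (intro add_mono divide_right_mono mult_left_mono drift False) auto
      also have "\<dots> = (\<rho> ^ Suc t * V x + b * (\<Sum>j<Suc t. \<rho> ^ j)) / c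
         + (\<Sum>j<Suc t. measure_pmf.prob (walk n \<beta> j x) B)"
        unfolding shift using False assms(1)
        by (simp add: prob_bind_finite finite_step finite_walk algebra_simps)
      finally show ?thesis .
    qed
  qed
  also have "(\<rho> ^ t * V x + b * (\<Sum>j<t. \<rho> ^ j)) / c \<le> (\<rho> ^ t * V x + b / (1 - \<rho>)) / c"
  proof -
    have "(\<Sum>j<t. \<rho> ^ j) \<le> 1 / (1 - \<rho>)"
      using assms(5,6) by (simp add: sum_gp_strict divide_right_mono)
    then have "b * (\<Sum>j<t. \<rho> ^ j) \<le> b * (1 / (1 - \<rho>))" using assms(4) by (intro mult_left_mono)
    then show ?thesis using assms(3) by (simp add: divide_right_mono)
  qed
  finally show ?thesis by simp
qed

section \<open>Concentration by the exponential of the potential\<close>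

lemma abs_exp_minus_one:
  fixes u :: real
  assumes "\<bar>u\<bar> \<le> 1"
  shows "\<bar>exp u - 1\<bar> \<le> 2 * \<bar>u\<bar>"
proof -
  have "u\<^sup>2 \<le> \<bar>u\<bar>"
    using assms mult_right_mono[of "\<bar>u\<bar>" 1 "\<bar>u\<bar>"] by (simp add: power2_eq_square)
  then show ?thesis
    using exp_le_quadratic[OF assms] exp_ge_add_one_self[of u] by linarith
qed

text \<open>The rise of the average changes the sum by at most \<open>2 * \<bar>s\<bar> / n\<close>
  times \<open>n * G\<close>, and the chosen bin adds at most
  \<open>4 * \<bar>s\<bar> * G\<close>.\<close>

lemma pot_place_diff:
  assumes "i < n" "\<bar>s\<bar> \<le> 1 / 200" and G: "\<And>j. j < n \<Longrightarrow> exp (s * norm_load n x j) \<le> G"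
  shows "\<bar>pot s n (place x i) - pot s n x\<bar> \<le> 6 * \<bar>s\<bar> * G"
proof -
  have n1: "real n \<ge> 1" using assms(1) by simp
  have G0: "G \<ge> 0" using G[OF assms(1)] exp_gt_zero[of "s * norm_load n x i"] by linarith
  have "\<bar>s\<bar> / n \<le> \<bar>s\<bar> / 1" using n1 by (intro divide_left_mono) auto
  then have sn: "\<bar>- s / n\<bar> \<le> 1 / 200" using assms(2) by (simp only: abs_divide abs_minus_cancel abs_of_nat)
  have e1: "\<bar>exp (- s / n) - 1\<bar> \<le> 2 * (\<bar>s\<bar> / n)"
    using abs_exp_minus_one[OF order_trans[OF sn]] by simp
  have e2: "exp (- s / n) \<le> 2"
    using abs_exp_minus_one[of "- s / n"] sn by linarith
  have e3: "\<bar>exp s - 1\<bar> \<le> 2 * \<bar>s\<bar>" using abs_exp_minus_one[of s] assms(2) by simp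
  have "pot s n x \<le> n * G"
    unfolding pot_def using sum_bounded_above[of "{..<n}" "\<lambda>j. exp (s * norm_load n x j)" G] G by simp
  then have "\<bar>exp (- s / n) - 1\<bar> * pot s n x \<le> 2 * (\<bar>s\<bar> / n) * (n * G)"
    using e1 pot_nonneg by (intro mult_mono) auto
  then have a: "\<bar>exp (- s / n) - 1\<bar> * pot s n x \<le> 2 * \<bar>s\<bar> * G" using n1 by simp
  have b: "exp (- s / n) * \<bar>exp s - 1\<bar> * exp (s * norm_load n x i) \<le> 2 * (2 * \<bar>s\<bar>) * G"
    using e2 e3 G[OF assms(1)] by (intro mult_mono) auto
  have "pot s n (place x i) - pot s n x
     = (exp (- s / n) - 1) * pot s n x + exp (- s / n) * (exp s - 1) * exp (s * norm_load n x i)"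
    unfolding pot_place[OF assms(1)] by (simp add: algebra_simps)
  also have "\<bar>\<dots>\<bar> \<le> \<bar>exp (- s / n) - 1\<bar> * pot s n x + exp (- s / n) * \<bar>exp s - 1\<bar> * exp (s * norm_load n x i)"
    using abs_triangle_ineq pot_nonneg[of s n x] by (auto simp: abs_mult intro: order_trans[OF abs_triangle_ineq])
  also have "\<dots> \<le> 6 * \<bar>s\<bar> * G" using a b by linarith
  finally show ?thesis .
qed

text \<open>Outside \<open>spread n H\<close> one ball changes the potential by at most
  \<open>G\<close>. Above \<open>K * n\<close> the expected change is at most -1, and
  \<open>\<theta>\<close> is chosen so that the second-order term
  \<open>\<theta>\<^sup>2 * G\<^sup>2\<close> uses up exactly half of the gain
  \<open>\<theta>\<close>. Below \<open>K * n\<close> the exponent grows by at most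
  \<open>\<theta> * G \<le> 1\<close>, whence the factor 3.\<close>

lemma exp_potential_drift:
  fixes \<alpha> \<beta> G K \<theta> :: real
  assumes "n > 0" "29 / 100 \<le> \<beta>" "\<beta> \<le> 1" "0 < \<alpha>" "\<alpha> \<le> 1 / 200" "G \<ge> 1"
    and K: "1 + \<alpha> \<le> 7 / 2000 * \<alpha> * K" and \<theta>: "\<theta> = 1 / (2 * G\<^sup>2)"
    and x: "x \<notin> spread n H" and H: "exp (\<alpha> * H) \<le> G"
  shows "measure_pmf.expectation (one_plus_beta_step n \<beta> x) (\<lambda>y. exp (\<theta> * potential \<alpha> n y))
    \<le> (1 - \<theta> / 2) * exp (\<theta> * potential \<alpha> n x) + 3 * exp (\<theta> * (K * n))"
proof -
  let ?P = "potential \<alpha> n x"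
  let ?E = "measure_pmf.expectation (bin_law n \<beta> x)"
  have n1: "real n \<ge> 1" using assms(1) by simp
  have \<theta>0: "0 < \<theta>" and \<theta>G: "\<theta> * G \<le> 1" and \<theta>1: "\<theta> \<le> 1" and \<theta>G2: "\<theta>\<^sup>2 * G\<^sup>2 = \<theta> / 2"
    using assms(6) mult_mono[of 1 G 1 G] unfolding \<theta> by (auto simp: field_simps power2_eq_square)
  have diff: "\<bar>potential \<alpha> n (place x i) - ?P\<bar> \<le> G" if "i < n" for i
  proof -
    have "exp (s * norm_load n x j) \<le> G" if "\<bar>s\<bar> = \<alpha>" "j < n" for s j
    proof -
      have "s * norm_load n x j \<le> \<bar>s * norm_load n x j\<bar>" by simp
      also have "\<dots> \<le> \<alpha> * H" using that x assms(4) by (auto simp: abs_mult spread_def not_le intro!: mult_left_mono)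
      finally have "exp (s * norm_load n x j) \<le> exp (\<alpha> * H)" by simp
      then show ?thesis using H by linarith
    qed
    then have "\<bar>pot s n (place x i) - pot s n x\<bar> \<le> 6 * \<bar>s\<bar> * G" if "\<bar>s\<bar> = \<alpha>" for s
      using assms(5) that \<open>i < n\<close> by (intro pot_place_diff) auto
    from this[of \<alpha>] this[of "- \<alpha>"]
    have "\<bar>pot \<alpha> n (place x i) - pot \<alpha> n x\<bar> \<le> 6 * \<bar>\<alpha>\<bar> * G"
      "\<bar>pot (- \<alpha>) n (place x i) - pot (- \<alpha>) n x\<bar> \<le> 6 * \<bar>- \<alpha>\<bar> * G"
      using assms(4) by auto
    moreover have "12 * \<alpha> * G \<le> 1 * G" using assms(5,6) by (intro mult_right_mono) auto
    ultimately show ?thesis using assms(4) unfolding potential_def by simp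
  qed
  show ?thesis
  proof (cases "K * n \<le> ?P")
    case True
    have "?E (\<lambda>i. exp (\<theta> * potential \<alpha> n (place x i)))
       = exp (\<theta> * ?P) * ?E (\<lambda>i. exp (\<theta> * (potential \<alpha> n (place x i) - ?P)))"
      by (simp add: right_diff_distrib exp_diff)
    also have "\<dots> \<le> exp (\<theta> * ?P) * ?E (\<lambda>i. 1 + \<theta> * (potential \<alpha> n (place x i) - ?P) + \<theta>\<^sup>2 * G\<^sup>2)"
    proof (intro mult_left_mono expectation_mono_finite finite_bin_law assms)
      fix i assume "i \<in> set_pmf (bin_law n \<beta> x)"
      then have i: "i < n" using bin_law_support[OF assms(1)] by auto
      let ?d = "potential \<alpha> n (place x i) - ?P"
      have "\<theta> * \<bar>?d\<bar> \<le> \<theta> * G" using diff[OF i] \<theta>0 by (intro mult_left_mono) auto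
      then have "\<bar>\<theta> * ?d\<bar> \<le> 1" using \<theta>G \<theta>0 by (simp only: abs_mult abs_of_pos)
      then have "exp (\<theta> * ?d) \<le> 1 + \<theta> * ?d + (\<theta> * ?d)\<^sup>2" by (rule exp_le_quadratic)
      moreover have "?d\<^sup>2 \<le> G\<^sup>2" using diff[OF i] assms(6) by (intro abs_le_square_iff[THEN iffD1]) auto
      then have "(\<theta> * ?d)\<^sup>2 \<le> \<theta>\<^sup>2 * G\<^sup>2" by (simp add: power_mult_distrib mult_left_mono)
      ultimately show "exp (\<theta> * ?d) \<le> 1 + \<theta> * ?d + \<theta>\<^sup>2 * G\<^sup>2" by linarith
    qed auto
    also have "?E (\<lambda>i. 1 + \<theta> * (potential \<alpha> n (place x i) - ?P) + \<theta>\<^sup>2 * G\<^sup>2)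
       = 1 + \<theta> * (?E (\<lambda>i. potential \<alpha> n (place x i)) - ?P) + \<theta>\<^sup>2 * G\<^sup>2"
      using assms(1) by (simp add: integrable_bin_law)
    also have "exp (\<theta> * ?P) * \<dots> \<le> exp (\<theta> * ?P) * (1 + \<theta> * (- 1) + \<theta>\<^sup>2 * G\<^sup>2)"
    proof (intro mult_left_mono add_mono order_refl)
      have "1 + \<alpha> \<le> 7 / 2000 * \<alpha> * K" by (rule K)
      also have "\<dots> \<le> 7 / 2000 * \<alpha> * (?P / n)" using True n1 assms(4) by (intro mult_left_mono) (auto simp: field_simps)
      finally show "?E (\<lambda>i. potential \<alpha> n (place x i)) - ?P \<le> - 1"
        using potential_drift[OF assms(1-5), of x] by (simp add: right_diff_distrib mult_ac)
    qed (use \<theta>0 in auto)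
    also have "\<dots> = (1 - \<theta> / 2) * exp (\<theta> * ?P)" unfolding \<theta>G2 by (simp add: algebra_simps)
    finally show ?thesis unfolding expectation_step
      using exp_gt_zero[of "\<theta> * (K * n)"] by linarith
  next
    case False
    have "?E (\<lambda>i. exp (\<theta> * potential \<alpha> n (place x i))) \<le> ?E (\<lambda>i. 3 * exp (\<theta> * (K * n)))"
    proof (intro expectation_mono_finite finite_bin_law assms)
      fix i assume "i \<in> set_pmf (bin_law n \<beta> x)"
      then have i: "i < n" using bin_law_support[OF assms(1)] by auto
      have "\<theta> * potential \<alpha> n (place x i) \<le> \<theta> * (K * n + G)"
        using diff[OF i] False \<theta>0 by (intro mult_left_mono) auto
      then have "exp (\<theta> * potential \<alpha> n (place x i)) \<le> exp (1 + \<theta> * (K * n))"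
        using \<theta>G by (simp add: algebra_simps)
      also have "\<dots> = exp 1 * exp (\<theta> * (K * n))" by (rule exp_add)
      also have "\<dots> \<le> 3 * exp (\<theta> * (K * n))" using e_less_272 by (intro mult_right_mono) auto
      finally show "exp (\<theta> * potential \<alpha> n (place x i)) \<le> 3 * exp (\<theta> * (K * n))" .
    qed
    also have "\<dots> = 3 * exp (\<theta> * (K * n))" by simp
    also have "\<dots> \<le> (1 - \<theta> / 2) * exp (\<theta> * ?P) + 3 * exp (\<theta> * (K * n))" using \<theta>1 by simp
    finally show ?thesis unfolding expectation_step .
  qed
qed

lemma prob_one_plus_beta_add:
  assumes "n > 0"
  shows "measure_pmf.prob (one_plus_beta n \<beta> (s + t)) A
     = measure_pmf.expectation (one_plus_beta n \<beta> s) (\<lambda>x. measure_pmf.prob (walk n \<beta> t x) A)"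
  using assms by (simp add: one_plus_beta_add prob_bind_finite finite_one_plus_beta finite_walk)

text \<open>Only the last \<open>n\<^sup>2\<close> balls are analysed: long enough to forget any
  start outside \<open>spread\<close>, short enough that a union bound over visits to
  \<open>spread\<close>, each of probability of order \<open>1 / n ^ 9\<close>, stays
  affordable.\<close>

lemma potential_concentration:
  "\<forall>\<^sub>F n in sequentially. \<forall>\<beta> m. 29 / 100 \<le> \<beta> \<and> \<beta> \<le> 1 \<longrightarrow>
     measure_pmf.prob (one_plus_beta n \<beta> m) {x. 6 * 10 ^ 6 * real n \<le> potential (1 / 8000) n x}
       \<le> 1 / real n ^ 4"
proof -
  have "\<forall>\<^sub>F n::nat in sequentially. (1 + 12 * sqrt n) / exp (sqrt n) + 2000 / 7 / real n ^ 7 \<le> 1 / real n ^ 4"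
    by real_asymp
  moreover have "\<forall>\<^sub>F n::nat in sequentially. 2 * real n powr (1 / 4) - real n / 2 \<le> 0"
    by real_asymp
  moreover have "\<forall>\<^sub>F n::nat in sequentially. n > 0" by (rule eventually_gt_at_top)
  ultimately show ?thesis
  proof eventually_elim
    case (elim n)
    show ?case
    proof (intro allI impI)
      fix \<beta> :: real and m :: nat
      assume \<beta>: "29 / 100 \<le> \<beta> \<and> \<beta> \<le> 1"
      \<comment> \<open>\<open>K\<close> makes the drift at most -1 for
        \<open>\<alpha> = 1 / 8000\<close>. \<open>H\<close> is chosen so that
        \<open>exp (H / 8000) = G\<close>, and \<open>G\<close> so that
        \<open>\<theta> = 1 / (2 * sqrt n)\<close>. The threshold at \<open>2 * K * n\<close> leaves
        a margin \<open>exp (\<theta> * (K * n)) \<ge> exp (sqrt n)\<close> over the level where the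
        drift balances.\<close>
      define K :: real where "K = 3 * 10 ^ 6"
      define G where "G = real n powr (1 / 4)"
      define \<theta> where "\<theta> = 1 / (2 * G\<^sup>2)"
      define H where "H = 2000 * ln n"
      define V where "V = (\<lambda>x. exp (\<theta> * potential (1 / 8000) n x))"
      define c where "c = exp (\<theta> * (2 * K * n))"
      let ?B = "spread n H"
      have n1: "real n \<ge> 1" using elim(3) by simp
      have G1: "G \<ge> 1" using n1 by (simp add: G_def ge_one_powr_ge_zero)
      have G2: "G\<^sup>2 = sqrt n" using n1 by (simp add: G_def powr_half_sqrt[symmetric] powr_powr flip: powr_numeral)
      have expH: "exp (1 / 8000 * H) = G" using n1 by (simp add: H_def G_def powr_def)
      have \<theta>: "0 < \<theta>" "\<theta> = 1 / (2 * sqrt n)" using n1 elim(3) by (simp_all add: \<theta>_def G2)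
      have \<theta>1: "\<theta> \<le> 1" using real_sqrt_ge_one[OF n1] unfolding \<theta>(2) by (subst divide_le_eq_1_pos) linarith+
      have \<theta>n: "\<theta> * (K * n) \<ge> sqrt n"
      proof -
        have "\<theta> * (K * n) = K / 2 * sqrt n" using n1 unfolding \<theta>(2) by (simp add: field_simps)
        moreover have "1 * sqrt n \<le> K / 2 * sqrt n" unfolding K_def by (intro mult_right_mono) auto
        ultimately show ?thesis by linarith
      qed
      have drift: "measure_pmf.expectation (one_plus_beta_step n \<beta> x) V \<le> (1 - \<theta> / 2) * V x + 3 * exp (\<theta> * (K * n))"
        if "x \<notin> ?B" for x
        unfolding V_def using that elim(3) \<beta> G1 expH
        by (intro exp_potential_drift[where G = G and H = H]) (auto simp: \<theta>_def K_def)
      have walk: "measure_pmf.prob (walk n \<beta> t x) {y. c \<le> V y}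
          \<le> (1 + 12 * sqrt n) / exp (sqrt n) + (\<Sum>j<t. measure_pmf.prob (walk n \<beta> j x) ?B)"
        if start: "(1 - \<theta> / 2) ^ t * V x \<le> exp (\<theta> * (K * n))" for t x
      proof -
        have "measure_pmf.prob (walk n \<beta> t x) {y. c \<le> V y}
          \<le> ((1 - \<theta> / 2) ^ t * V x + 3 * exp (\<theta> * (K * n)) / (1 - (1 - \<theta> / 2))) / c
            + (\<Sum>j<t. measure_pmf.prob (walk n \<beta> j x) ?B)"
          using \<theta> \<theta>1 elim(3) by (intro prob_walk_drift drift) (auto simp: V_def c_def)
        also have "((1 - \<theta> / 2) ^ t * V x + 3 * exp (\<theta> * (K * n)) / (1 - (1 - \<theta> / 2))) / c
           \<le> (exp (\<theta> * (K * n)) + 3 * exp (\<theta> * (K * n)) / (1 - (1 - \<theta> / 2))) / c"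
          using start \<theta>(1) by (intro divide_right_mono add_mono) (auto simp: c_def)
        also have "\<dots> = (1 + 12 * sqrt n) / exp (\<theta> * (K * n))"
        proof -
          have "c = exp (\<theta> * (K * n)) * exp (\<theta> * (K * n))"
            unfolding c_def by (simp flip: exp_add)
          then show ?thesis using n1 unfolding \<theta>(2) by (simp add: field_simps)
        qed
        also have "\<dots> \<le> (1 + 12 * sqrt n) / exp (sqrt n)"
          using \<theta>n by (intro divide_left_mono) auto
        finally show ?thesis by simp
      qed
      have main: "measure_pmf.prob (walk n \<beta> t x) {y. c \<le> V y}
          \<le> (1 + 12 * sqrt n) / exp (sqrt n) + (\<Sum>j<t. measure_pmf.prob (walk n \<beta> j x) ?B)"
        if "t = n\<^sup>2 \<or> x = (\<lambda>_. 0)" for t x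
      proof (cases "x = (\<lambda>_. 0)")
        case True
        have "(1 - \<theta> / 2) ^ t * V x \<le> 1 * V x"
          using \<theta> \<theta>1 by (intro mult_right_mono power_le_one) (auto simp: V_def)
        also have "\<dots> \<le> exp (\<theta> * (K * n))"
          using \<theta>(1) by (auto simp: V_def True potential_zero K_def)
        finally show ?thesis by (rule walk)
      next
        case False
        then have t: "t = n\<^sup>2" using that by simp
        show ?thesis
        proof (cases "x \<in> ?B")
          case True
          \<comment> \<open>A start in \<open>?B\<close> makes the summand for \<open>j = 0\<close>
            equal to 1, so nothing is left to show.\<close>
          have "1 = measure_pmf.prob (walk n \<beta> 0 x) ?B" using True by (simp add: measure_return_pmf)
          also have "\<dots> \<le> (\<Sum>j<t. measure_pmf.prob (walk n \<beta> j x) ?B)"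
            using elim(3) t by (intro member_le_sum) auto
          finally have "1 \<le> (\<Sum>j<t. measure_pmf.prob (walk n \<beta> j x) ?B)" .
          moreover have "0 \<le> (1 + 12 * sqrt n) / exp (sqrt n)" by simp
          moreover have "measure_pmf.prob (walk n \<beta> t x) {y. c \<le> V y} \<le> 1" by simp
          ultimately show ?thesis by linarith
        next
          case False
          have "exp (s * norm_load n x i) \<le> G" if "\<bar>s\<bar> = 1 / 8000" "i < n" for s i
          proof -
            have "s * norm_load n x i \<le> \<bar>s * norm_load n x i\<bar>" by simp
            also have "\<dots> \<le> 1 / 8000 * H" unfolding abs_mult that(1) using that(2) False by (auto simp: spread_def not_le)
            finally show ?thesis by (simp only: exp_le_cancel_iff flip: expH)
          qed
          then have "pot s n x \<le> n * G" if "\<bar>s\<bar> = 1 / 8000" for s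
            unfolding pot_def using that sum_bounded_above[of "{..<n}" "\<lambda>j. exp (s * norm_load n x j)" G] by simp
          from this[of "1 / 8000"] this[of "- (1 / 8000)"]
          have P: "potential (1 / 8000) n x \<le> 2 * n * G" by (simp add: potential_def)
          \<comment> \<open>The starting potential is at most \<open>2 * n * G\<close>, of order
            \<open>n powr (5 / 4)\<close>, and \<open>n\<^sup>2\<close> contractions lower the
            exponent by \<open>\<theta> * n\<^sup>2 / 2\<close>, which outweighs it.\<close>
          have "(1 - \<theta> / 2) ^ t \<le> exp (- (\<theta> / 2)) ^ t"
            using exp_ge_add_one_self[of "- (\<theta> / 2)"] \<theta>1 by (intro power_mono) auto
          also have "\<dots> = exp (- (\<theta> * (n * n / 2)))" by (simp add: t exp_of_nat_mult[symmetric] power2_eq_square)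
          finally have "(1 - \<theta> / 2) ^ t * V x \<le> exp (- (\<theta> * (n * n / 2))) * exp (\<theta> * (2 * n * G))"
            unfolding V_def using P \<theta>(1) by (intro mult_mono) auto
          also have "\<dots> = exp (\<theta> * (n * (2 * G - n / 2)))" by (simp add: algebra_simps flip: exp_add)
          also have "\<dots> \<le> exp (\<theta> * (K * n))"
          proof -
            have "n * (2 * G - n / 2) \<le> real n * 0"
              using elim(2) by (intro mult_left_mono) (auto simp: G_def)
            moreover have "0 \<le> K * n" by (simp add: K_def)
            ultimately have "n * (2 * G - n / 2) \<le> K * n" by linarith
            then show ?thesis using \<theta>(1) by simp
          qed
          finally show ?thesis by (rule walk)
        qed
      qed
      \<comment> \<open>Either the window starts from empty bins or it has full length; these are
        the two alternatives in \<open>main\<close>.\<close>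
      obtain s t where st: "m = s + t" "t \<le> n\<^sup>2" "s = 0 \<or> t = n\<^sup>2"
      proof (cases "m \<le> n\<^sup>2")
        case True
        then show ?thesis using that[of 0 m] by simp
      next
        case False
        then show ?thesis using that[of "m - n\<^sup>2" "n\<^sup>2"] by simp
      qed
      have int: "integrable (measure_pmf (one_plus_beta n \<beta> s)) f" for f :: "loads \<Rightarrow> real"
        by (rule integrable_measure_pmf_finite[OF finite_one_plus_beta[OF elim(3)]])
      have "measure_pmf.prob (one_plus_beta n \<beta> m) {y. c \<le> V y}
        = measure_pmf.expectation (one_plus_beta n \<beta> s) (\<lambda>x. measure_pmf.prob (walk n \<beta> t x) {y. c \<le> V y})"
        unfolding st(1) by (rule prob_one_plus_beta_add[OF elim(3)])
      also have "\<dots> \<le> measure_pmf.expectation (one_plus_beta n \<beta> s)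
          (\<lambda>x. (1 + 12 * sqrt n) / exp (sqrt n) + (\<Sum>j<t. measure_pmf.prob (walk n \<beta> j x) ?B))"
      proof (intro expectation_mono_finite finite_one_plus_beta elim main)
        fix x assume "x \<in> set_pmf (one_plus_beta n \<beta> s)"
        then show "t = n\<^sup>2 \<or> x = (\<lambda>_. 0)" using st(3) by auto
      qed
      also have "\<dots> = (1 + 12 * sqrt n) / exp (sqrt n)
          + (\<Sum>j<t. measure_pmf.prob (one_plus_beta n \<beta> (s + j)) ?B)"
        using elim(3) by (simp add: int prob_one_plus_beta_add)
      also have "(\<Sum>j<t. measure_pmf.prob (one_plus_beta n \<beta> (s + j)) ?B) \<le> real (n\<^sup>2) * (2000 / 7 * n * exp (- H / 200))"
      proof -
        have "(\<Sum>j<t. measure_pmf.prob (one_plus_beta n \<beta> (s + j)) ?B) \<le> (\<Sum>j<t. 2000 / 7 * n * exp (- H / 200))"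
          using \<beta> elim(3) by (intro sum_mono prob_spread) auto
        also have "\<dots> = real t * (2000 / 7 * n * exp (- H / 200))" by simp
        also have "\<dots> \<le> real (n\<^sup>2) * (2000 / 7 * n * exp (- H / 200))"
          using st(2) by (intro mult_right_mono) (simp_all only: of_nat_le_iff, simp)
        finally show ?thesis .
      qed
      also have "\<dots> = 2000 / 7 / real n ^ 7"
      proof -
        have "exp (- H / 200) = inverse (real n) ^ 10"
          using n1 exp_of_nat_mult[of 10 "- ln n"] by (simp add: H_def exp_minus)
        then show ?thesis using n1 by (simp add: field_simps power_eq_if)
      qed
      finally have "measure_pmf.prob (one_plus_beta n \<beta> m) {y. c \<le> V y} \<le> 1 / real n ^ 4"
        using elim(1) by linarith
      moreover have "{y. c \<le> V y} = {x. 6 * 10 ^ 6 * real n \<le> potential (1 / 8000) n x}"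
        using \<theta>(1) by (auto simp: c_def V_def K_def)
      ultimately show "measure_pmf.prob (one_plus_beta n \<beta> m) {x. 6 * 10 ^ 6 * real n \<le> potential (1 / 8000) n x}
         \<le> 1 / real n ^ 4" by simp
    qed
  qed
qed

section \<open>Layered induction\<close>

definition heavy :: "nat \<Rightarrow> nat \<Rightarrow> loads \<Rightarrow> nat" where
  "heavy n h x = card {i\<in>{..<n}. h \<le> x i}"

text \<open>Truncated subtraction makes this the number of balls above level \<open>h\<close>.
  Unlike \<open>heavy n (Suc h)\<close>, it goes up by exactly one with every ball that hits a bin
  of load at least \<open>h\<close>, which suits a moment generating function.\<close>

definition overflow :: "nat \<Rightarrow> nat \<Rightarrow> loads \<Rightarrow> nat" where
  "overflow n h x = (\<Sum>i<n. x i - h)"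

lemma heavy_Suc_le_overflow: "heavy n (Suc h) x \<le> overflow n h x"
proof -
  have "heavy n (Suc h) x = (\<Sum>i<n. if Suc h \<le> x i then 1 else 0)"
    by (simp add: heavy_def sum.If_cases Int_def)
  also have "\<dots> \<le> overflow n h x" unfolding overflow_def by (intro sum_mono) auto
  finally show ?thesis .
qed

lemma overflow_place:
  assumes "i < n"
  shows "overflow n h (place x i) = overflow n h x + (if h \<le> x i then 1 else 0)"
proof -
  have "overflow n h (place x i) = (\<Sum>j<n. (x j - h) + (if j = i then (if h \<le> x i then 1 else 0) else 0))"
    unfolding overflow_def by (intro sum.cong) (auto simp: place_def)
  then show ?thesis using assms by (simp add: sum.distrib overflow_def)
qed

lemma place_mono: "x j \<le> place x i j"
  by (simp add: place_def)

lemma walk_mono: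
  assumes "n > 0" "y \<in> set_pmf (walk n \<beta> t x)"
  shows "x j \<le> y j"
  using assms(2)
proof (induction t arbitrary: x)
  case (Suc t)
  then obtain z where z: "z \<in> set_pmf (one_plus_beta_step n \<beta> x)" "y \<in> set_pmf (walk n \<beta> t z)" by auto
  have "x j \<le> z j" using set_step[OF assms(1) z(1)] place_mono by auto
  then show ?case using Suc.IH[OF z(2)] by simp
qed simp

section \<open>Balls falling on heavy bins\<close>

lemma heavy_mono: "(\<And>j. x j \<le> y j) \<Longrightarrow> heavy n h x \<le> heavy n h y"
  unfolding heavy_def by (intro card_mono) (auto intro: order_trans)

text \<open>The indicator of \<open>h \<le> x i\<close> is monotone in the load. If it holds for a
  fraction \<open>p\<close> of the bins, its mean difference is
  \<open>2 * p - 2 * p\<^sup>2\<close>, which leaves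
  \<open>\<beta> * p\<^sup>2 + (1 - \<beta>) * p\<close>.\<close>

lemma prob_hit_heavy:
  assumes "n > 0" "0 \<le> \<beta>" "\<beta> \<le> 1" "1 - \<beta> \<le> \<delta>" "real (heavy n h x) \<le> \<nu>"
  shows "measure_pmf.expectation (bin_law n \<beta> x) (\<lambda>i. if h \<le> x i then 1 else 0)
    \<le> (\<nu> / n)\<^sup>2 + \<delta> * (\<nu> / n)"
proof -
  let ?g = "\<lambda>i. if h \<le> x i then 1 else (0::real)"
  let ?N = "real (heavy n h x)"
  have N: "(\<Sum>i<n. ?g i) = ?N" by (simp add: heavy_def sum.If_cases Int_def)
  have "(\<Sum>i<n. \<Sum>j<n. \<bar>?g i - ?g j\<bar>) = (\<Sum>i<n. \<Sum>j<n. 2 * ((?g i + ?g j) / 2) - 2 * (?g i * ?g j))"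
    by (intro sum.cong) auto
  also have "\<dots> = 2 * (n * ?N) - 2 * (?N * ?N)"
    unfolding sum_subtractf sum_distrib_left[symmetric] sum_pairs_avg N
    by (simp add: N flip: sum_distrib_right)
  finally have md: "mean_diff n ?g = 2 * (?N / n) - 2 * (?N / n)\<^sup>2"
    using assms(1) by (simp add: mean_diff_def power2_eq_square field_simps)
  have "measure_pmf.expectation (bin_law n \<beta> x) ?g = ?N / n - \<beta> / 2 * mean_diff n ?g"
    using expectation_bin_law_mono[OF assms(1-3), of x ?g] N by auto
  also have "\<dots> = \<beta> * (?N / n)\<^sup>2 + (1 - \<beta>) * (?N / n)" unfolding md by (simp add: algebra_simps diff_divide_distrib)
  also have "\<dots> \<le> 1 * (\<nu> / n)\<^sup>2 + \<delta> * (\<nu> / n)"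
    using assms by (intro add_mono mult_mono power_mono divide_right_mono) auto
  finally show ?thesis by simp
qed

text \<open>Loads never decrease, so a final state with at most \<open>\<nu>\<close> heavy bins had
  at most \<open>\<nu>\<close> of them throughout. It therefore suffices to cut off at the end: as
  long as a path can still count, each ball hits a heavy bin with probability at most
  \<open>q\<close>.\<close>

lemma expectation_overflow_mgf:
  fixes M \<nu> \<delta> :: real
  assumes "n > 0" "0 \<le> \<beta>" "\<beta> \<le> 1" "1 - \<beta> \<le> \<delta>" "1 \<le> M" "0 \<le> \<nu>"
  defines "q \<equiv> (\<nu> / n)\<^sup>2 + \<delta> * (\<nu> / n)"
  shows "measure_pmf.expectation (walk n \<beta> t x) (\<lambda>y. if heavy n h y \<le> \<nu> then M ^ overflow n h y else 0)
    \<le> (1 + (M - 1) * q) ^ t * M ^ overflow n h x"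
proof (induction t arbitrary: x)
  case 0
  show ?case using assms(5) by simp
next
  case (Suc t)
  let ?f = "\<lambda>y. if heavy n h y \<le> \<nu> then M ^ overflow n h y else 0"
  have q0: "0 \<le> q" using assms by (auto simp: q_def)
  then have r0: "0 \<le> (M - 1) * q" using assms(5) by simp
  show ?case
  proof (cases "heavy n h x \<le> \<nu>")
    case True
    have "measure_pmf.expectation (walk n \<beta> (Suc t) x) ?f
       = measure_pmf.expectation (one_plus_beta_step n \<beta> x) (\<lambda>z. measure_pmf.expectation (walk n \<beta> t z) ?f)"
      using assms(1) by (simp add: expectation_bind_finite finite_step finite_walk)
    also have "\<dots> \<le> measure_pmf.expectation (one_plus_beta_step n \<beta> x) (\<lambda>z. (1 + (M - 1) * q) ^ t * M ^ overflow n h z)"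
      by (intro expectation_mono_finite finite_step assms Suc.IH)
    also have "\<dots> = (1 + (M - 1) * q) ^ t * measure_pmf.expectation (bin_law n \<beta> x) (\<lambda>i. M ^ overflow n h (place x i))"
      by (simp add: expectation_step)
    also have "measure_pmf.expectation (bin_law n \<beta> x) (\<lambda>i. M ^ overflow n h (place x i))
       = measure_pmf.expectation (bin_law n \<beta> x) (\<lambda>i. M ^ overflow n h x * (1 + (M - 1) * (if h \<le> x i then 1 else 0)))"
      using assms(1) by (intro expectation_bin_law_cong) (auto simp: overflow_place)
    also have "\<dots> = M ^ overflow n h x * (1 + (M - 1) * measure_pmf.expectation (bin_law n \<beta> x) (\<lambda>i. if h \<le> x i then 1 else 0))"
      using assms(1) by (simp add: integrable_bin_law del: Bochner_Integration.integral_indicator)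
    also have "(1 + (M - 1) * q) ^ t * \<dots> \<le> (1 + (M - 1) * q) ^ t * (M ^ overflow n h x * (1 + (M - 1) * q))"
      unfolding q_def using assms(5) r0 True assms
      by (intro mult_left_mono add_left_mono prob_hit_heavy) (auto simp: q_def)
    finally show ?thesis by (simp add: mult_ac)
  next
    case False
    have "measure_pmf.expectation (walk n \<beta> (Suc t) x) ?f = measure_pmf.expectation (walk n \<beta> (Suc t) x) (\<lambda>y. 0)"
    proof (rule integral_cong_AE)
      show "AE y in walk n \<beta> (Suc t) x. ?f y = 0"
      proof (rule AE_pmfI)
        fix y assume "y \<in> set_pmf (walk n \<beta> (Suc t) x)"
        then have "heavy n h x \<le> heavy n h y" by (intro heavy_mono walk_mono[OF assms(1)])
        then show "?f y = 0" using False by auto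
      qed
    qed auto
    then show ?thesis using r0 assms(5) by simp
  qed
qed

text \<open>A Chernoff bound whose base \<open>M\<close> is left open: \<open>layers_step\<close>
  takes 2, and \<open>prob_window\<close> takes the reciprocal of a bound on the mean.\<close>

lemma prob_overflow:
  fixes M \<nu> \<delta> r :: real
  assumes "n > 0" "0 \<le> \<beta>" "\<beta> \<le> 1" "1 - \<beta> \<le> \<delta>" "1 \<le> M" "0 \<le> \<nu>" "overflow n h x = 0"
  shows "measure_pmf.prob (walk n \<beta> t x) {y. heavy n h y \<le> \<nu> \<and> r \<le> overflow n h y}
    \<le> exp ((M - 1) * (((\<nu> / n)\<^sup>2 + \<delta> * (\<nu> / n)) * t)) / M powr r"
proof -
  let ?f = "\<lambda>y. if heavy n h y \<le> \<nu> then M ^ overflow n h y else 0"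
  define q where "q = (\<nu> / n)\<^sup>2 + \<delta> * (\<nu> / n)"
  have q0: "0 \<le> (M - 1) * q" using assms by (auto simp: q_def)
  have "measure_pmf.prob (walk n \<beta> t x) {y. heavy n h y \<le> \<nu> \<and> r \<le> overflow n h y}
     \<le> measure_pmf.prob (walk n \<beta> t x) {y. M powr r \<le> ?f y}"
  proof (rule prob_mono_support)
    fix y assume y: "y \<in> {y. heavy n h y \<le> \<nu> \<and> r \<le> overflow n h y}"
    then have "M powr r \<le> M powr (real (overflow n h y))" using assms(5) by (intro powr_mono) auto
    then show "y \<in> {y. M powr r \<le> ?f y}" using y assms(5) by (simp add: powr_realpow)
  qed
  also have "\<dots> \<le> measure_pmf.expectation (walk n \<beta> t x) ?f / M powr r"
    using assms by (intro prob_Markov finite_walk) auto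
  also have "\<dots> \<le> (1 + (M - 1) * q) ^ t * M ^ overflow n h x / M powr r"
    unfolding q_def using assms by (intro divide_right_mono expectation_overflow_mgf) auto
  also have "\<dots> \<le> exp ((M - 1) * q) ^ t * 1 / M powr r"
    using q0 exp_ge_add_one_self[of "(M - 1) * q"] assms
    by (intro divide_right_mono mult_mono power_mono) auto
  also have "\<dots> = exp ((M - 1) * (q * t)) / M powr r"
    by (simp add: exp_of_nat_mult[symmetric] mult_ac)
  finally show ?thesis unfolding q_def .
qed

lemma overflow_eq_0: "(\<And>i. i < n \<Longrightarrow> x i \<le> h) \<Longrightarrow> overflow n h x = 0"
  by (simp add: overflow_def)

text \<open>All loads start at most at \<open>h\<close>, so every ball above \<open>h\<close> falls
  within the window. Since \<open>ln 2 \<ge> 2 / 3\<close>, twice the mean plus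
  \<open>10 * ln n\<close>, times \<open>ln 2\<close>, exceeds the mean by at least
  \<open>6 * ln n\<close>.\<close>

lemma layers_step:
  fixes \<nu> \<nu>' \<delta> T :: real
  assumes "n > 0" "0 \<le> \<beta>" "\<beta> \<le> 1" "1 - \<beta> \<le> \<delta>" "0 \<le> \<nu>"
    and x: "\<And>i. i < n \<Longrightarrow> x i \<le> h" and "real t \<le> T"
    and rec: "2 * (((\<nu> / n)\<^sup>2 + \<delta> * (\<nu> / n)) * T) + 10 * ln n \<le> \<nu>'"
  shows "measure_pmf.prob (walk n \<beta> t x) {y. \<nu>' < heavy n (Suc h) y}
    \<le> measure_pmf.prob (walk n \<beta> t x) {y. \<nu> < heavy n h y} + 1 / real n ^ 6"
proof -
  let ?P = "measure_pmf.prob (walk n \<beta> t x)"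
  let ?Q = "((\<nu> / n)\<^sup>2 + \<delta> * (\<nu> / n)) * T"
  have n1: "real n \<ge> 1" using assms(1) by simp
  have Q0: "0 \<le> ?Q" "0 \<le> (\<nu> / n)\<^sup>2 + \<delta> * (\<nu> / n)" using assms by auto
  have "?P {y. \<nu>' < heavy n (Suc h) y} \<le> ?P ({y. \<nu> < heavy n h y} \<union> {y. heavy n h y \<le> \<nu> \<and> \<nu>' \<le> overflow n h y})"
  proof (rule prob_mono_support)
    fix y assume "y \<in> {y. \<nu>' < heavy n (Suc h) y}"
    moreover have "real (heavy n (Suc h) y) \<le> real (overflow n h y)"
      using heavy_Suc_le_overflow[of n h y] by simp
    ultimately show "y \<in> {y. \<nu> < heavy n h y} \<union> {y. heavy n h y \<le> \<nu> \<and> \<nu>' \<le> overflow n h y}" by auto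
  qed
  also have "\<dots> \<le> ?P {y. \<nu> < heavy n h y} + ?P {y. heavy n h y \<le> \<nu> \<and> \<nu>' \<le> overflow n h y}"
    by (intro measure_Un_le) auto
  also have "?P {y. heavy n h y \<le> \<nu> \<and> \<nu>' \<le> overflow n h y}
     \<le> exp ((2 - 1) * (((\<nu> / n)\<^sup>2 + \<delta> * (\<nu> / n)) * t)) / 2 powr \<nu>'"
    using assms by (intro prob_overflow overflow_eq_0) auto
  also have "\<dots> = exp (((\<nu> / n)\<^sup>2 + \<delta> * (\<nu> / n)) * t - \<nu>' * ln 2)"
    by (simp add: powr_def exp_diff)
  also have "\<dots> \<le> exp (6 * (- ln n))"
  proof -
    have "((\<nu> / n)\<^sup>2 + \<delta> * (\<nu> / n)) * t \<le> ?Q" using assms(7) Q0 by (intro mult_left_mono) auto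
    moreover have "0 \<le> ln (real n)" using n1 by simp
    then have "\<nu>' \<ge> 0" using rec Q0(1) by linarith
    then have "\<nu>' * (2 / 3) \<le> \<nu>' * ln 2" using ln2_ge_two_thirds by (intro mult_left_mono)
    moreover have "a - w \<le> 6 * - l"
      if "a \<le> q" "v * (2 / 3) \<le> w" "2 * q + 10 * l \<le> v" "0 \<le> q" "0 \<le> l" for a v w q l :: real
      using that by linarith
    ultimately show ?thesis
      unfolding exp_le_cancel_iff using rec Q0(1) \<open>0 \<le> ln (real n)\<close> by blast
  qed
  also have "\<dots> = 1 / real n ^ 6"
    using n1 exp_of_nat_mult[of 6 "- ln n"] by (simp add: exp_minus field_simps)
  finally show ?thesis by simp
qed

lemma layers:
  fixes \<nu> :: "nat \<Rightarrow> real" and T :: real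
  assumes "n > 0" "0 \<le> \<beta>" "\<beta> \<le> 1" "1 - \<beta> \<le> \<delta>" "\<And>i. 0 \<le> \<nu> i"
    and x: "\<And>i. i < n \<Longrightarrow> x i \<le> h" and "real t \<le> T"
    and rec: "\<And>i. 2 * (((\<nu> i / n)\<^sup>2 + \<delta> * (\<nu> i / n)) * T) + 10 * ln n \<le> \<nu> (Suc i)"
  shows "measure_pmf.prob (walk n \<beta> t x) {y. \<nu> i < heavy n (h + i) y}
    \<le> measure_pmf.prob (walk n \<beta> t x) {y. \<nu> 0 < heavy n h y} + i / real n ^ 6"
proof (induction i)
  case (Suc i)
  have "measure_pmf.prob (walk n \<beta> t x) {y. \<nu> (Suc i) < heavy n (h + Suc i) y}
      \<le> measure_pmf.prob (walk n \<beta> t x) {y. \<nu> i < heavy n (h + i) y} + 1 / real n ^ 6"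
    unfolding add_Suc_right using assms by (intro layers_step[where T = T and \<delta> = \<delta>]) (auto intro: trans_le_add1)
  then show ?case using Suc by (simp add: add_divide_distrib)
qed simp

text \<open>A single bin of load \<open>h + l + r\<close> gives overflow \<open>r\<close> above
  \<open>h + l\<close>. Where at most \<open>Q \<le> 1\<close> such balls are expected, the base
  \<open>1 / Q\<close> turns the Chernoff bound into \<open>Q ^ r\<close>, times at most
  \<open>exp ((1 / Q - 1) * Q) \<le> 3\<close>.\<close>

lemma prob_window:
  fixes \<nu> :: "nat \<Rightarrow> real" and Q T :: real
  assumes "n > 0" "0 \<le> \<beta>" "\<beta> \<le> 1" "1 - \<beta> \<le> \<delta>" "\<And>i. 0 \<le> \<nu> i"
    and x: "\<And>i. i < n \<Longrightarrow> x i \<le> h" and "real t \<le> T"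
    and rec: "\<And>i. 2 * (((\<nu> i / n)\<^sup>2 + \<delta> * (\<nu> i / n)) * T) + 10 * ln n \<le> \<nu> (Suc i)"
    and Q: "((\<nu> l / n)\<^sup>2 + \<delta> * (\<nu> l / n)) * T \<le> Q" "0 < Q" "Q \<le> 1"
  shows "measure_pmf.prob (walk n \<beta> t x) {y. \<exists>i<n. h + l + r \<le> y i}
    \<le> measure_pmf.prob (walk n \<beta> t x) {y. \<nu> 0 < heavy n h y} + l / real n ^ 6 + 3 * Q ^ r"
proof -
  let ?P = "measure_pmf.prob (walk n \<beta> t x)"
  have q0: "0 \<le> (\<nu> l / n)\<^sup>2 + \<delta> * (\<nu> l / n)" using assms by auto
  have "?P {y. \<exists>i<n. h + l + r \<le> y i}
    \<le> ?P ({y. \<nu> l < heavy n (h + l) y} \<union> {y. heavy n (h + l) y \<le> \<nu> l \<and> real r \<le> overflow n (h + l) y})"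
  proof (rule prob_mono_support)
    fix y assume "y \<in> {y. \<exists>i<n. h + l + r \<le> y i}"
    then obtain i where i: "i < n" "h + l + r \<le> y i" by auto
    then have "r \<le> y i - (h + l)" by simp
    also have "\<dots> \<le> overflow n (h + l) y" unfolding overflow_def using i by (intro member_le_sum) auto
    finally show "y \<in> {y. \<nu> l < heavy n (h + l) y} \<union> {y. heavy n (h + l) y \<le> \<nu> l \<and> real r \<le> overflow n (h + l) y}"
      by auto
  qed
  also have "\<dots> \<le> ?P {y. \<nu> l < heavy n (h + l) y} + ?P {y. heavy n (h + l) y \<le> \<nu> l \<and> real r \<le> overflow n (h + l) y}"
    by (intro measure_Un_le) auto
  also have "?P {y. heavy n (h + l) y \<le> \<nu> l \<and> real r \<le> overflow n (h + l) y}
     \<le> exp ((1 / Q - 1) * (((\<nu> l / n)\<^sup>2 + \<delta> * (\<nu> l / n)) * t)) / (1 / Q) powr real r"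
    using assms by (intro prob_overflow overflow_eq_0) (auto intro: trans_le_add1)
  also have "\<dots> = exp ((1 / Q - 1) * (((\<nu> l / n)\<^sup>2 + \<delta> * (\<nu> l / n)) * t)) * Q ^ r"
    using Q(2) by (simp add: powr_realpow power_one_over field_simps)
  also have "\<dots> \<le> 3 * Q ^ r"
  proof (intro mult_right_mono)
    have "((\<nu> l / n)\<^sup>2 + \<delta> * (\<nu> l / n)) * t \<le> ((\<nu> l / n)\<^sup>2 + \<delta> * (\<nu> l / n)) * T"
      using q0 assms(7) by (intro mult_left_mono) auto
    then have "(1 / Q - 1) * (((\<nu> l / n)\<^sup>2 + \<delta> * (\<nu> l / n)) * t) \<le> (1 / Q - 1) * Q"
      using Q by (intro mult_left_mono) auto
    also have "\<dots> \<le> 1" using Q(2) by (simp add: algebra_simps)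
    finally have "exp ((1 / Q - 1) * (((\<nu> l / n)\<^sup>2 + \<delta> * (\<nu> l / n)) * t)) \<le> exp 1" by simp
    then show "exp ((1 / Q - 1) * (((\<nu> l / n)\<^sup>2 + \<delta> * (\<nu> l / n)) * t)) \<le> 3"
      using e_less_272 by linarith
  qed (use Q in auto)
  also have "?P {y. \<nu> l < heavy n (h + l) y} \<le> ?P {y. \<nu> 0 < heavy n h y} + l / real n ^ 6"
    using assms by (intro layers[where \<delta> = \<delta> and T = T]) auto
  finally show ?thesis by simp
qed

text \<open>Once the sequence drops below \<open>\<eta>\<close> it shrinks by a factor \<open>\<eta>\<close> per step; before that each step
  squares it. Hence \<open>a\<close> squarings or \<open>b\<close> multiplications have taken place among \<open>a + b\<close> steps.\<close>
lemma squaring_or_contracting: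
  fixes z :: "nat \<Rightarrow> real"
  assumes z0: "\<And>i. 0 \<le> z i" "z 0 \<le> 1 / 2" and "0 \<le> \<eta>" "\<eta> \<le> 1" "0 \<le> \<epsilon>" "\<epsilon> \<le> 1 / 2"
    and step: "\<And>i. z (Suc i) \<le> max (max ((z i)\<^sup>2) (\<eta> * z i)) \<epsilon>"
  shows "z (a + b) \<le> max (max ((1 / 2) ^ (2 ^ a)) (\<eta> ^ b)) \<epsilon>"
proof -
  \<comment> \<open>For \<open>a = 0\<close> or \<open>b = 0\<close> the claimed maximum is at least
    \<open>1 / 2\<close>, so this settles the border cases of the induction.\<close>
  have half: "z i \<le> 1 / 2" for i
  proof (induction i)
    case (Suc i)
    have "(z i)\<^sup>2 \<le> 1 * z i"
      unfolding power2_eq_square using Suc z0(1)[of i] by (intro mult_right_mono) auto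
    moreover have "\<eta> * z i \<le> 1 * z i" using assms z0(1) by (intro mult_right_mono) auto
    ultimately show ?case using step[of i] Suc assms(6) by linarith
  qed (rule z0)
  have "i = a + b \<Longrightarrow> z i \<le> max (max ((1 / 2) ^ (2 ^ a)) (\<eta> ^ b)) \<epsilon>" for i
  proof (induction i arbitrary: a b)
    case 0
    then show ?case using z0(2) by simp
  next
    case (Suc i)
    have sq: "y * y \<le> max (max ((1 / 2) ^ (2 ^ Suc a)) (\<eta> ^ b)) \<epsilon>"
      if y: "0 \<le> y" "y \<le> max (max ((1 / 2) ^ (2 ^ a)) (\<eta> ^ b)) \<epsilon>" for y a
    proof -
      let ?M = "max (max ((1 / 2) ^ (2 ^ a)) (\<eta> ^ b)) \<epsilon>"
      consider "y \<le> (1 / 2) ^ (2 ^ a)" | "y \<le> \<eta> ^ b" | "y \<le> \<epsilon>" using y(2) by linarith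
      then show ?thesis
      proof cases
        case 1
        then have "y * y \<le> (1 / 2) ^ (2 ^ a) * (1 / 2) ^ (2 ^ a)" using y(1) by (intro mult_mono) auto
        also have "\<dots> = (1 / 2) ^ (2 ^ Suc a)" by (simp flip: power_add mult_2)
        finally show ?thesis by simp
      next
        case 2
        then have "y * y \<le> \<eta> ^ b * 1" using y(1) assms(3,4) power_le_one[of \<eta> b] by (intro mult_mono) auto
        then show ?thesis by simp
      next
        case 3
        then have "y * y \<le> \<epsilon> * 1" using y(1) assms(5,6) by (intro mult_mono) auto
        then show ?thesis by simp
      qed
    qed
    have mul: "\<eta> * y \<le> max (max ((1 / 2) ^ (2 ^ a)) (\<eta> ^ Suc b)) \<epsilon>"
      if y: "0 \<le> y" "y \<le> max (max ((1 / 2) ^ (2 ^ a)) (\<eta> ^ b)) \<epsilon>" for y b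
    proof -
      consider "y \<le> (1 / 2) ^ (2 ^ a)" | "y \<le> \<eta> ^ b" | "y \<le> \<epsilon>" using y(2) by linarith
      moreover have "\<eta> * y \<le> 1 * y" using y(1) assms(4) by (intro mult_right_mono)
      ultimately show ?thesis
      proof cases
        case 2
        then have "\<eta> * y \<le> \<eta> ^ Suc b" using assms(3) by (simp add: mult_left_mono)
        then show ?thesis by simp
      qed auto
    qed
    consider "a = 0" | "b = 0" | a' b' where "a = Suc a'" "b = Suc b'" using not0_implies_Suc by blast
    then show ?case
    proof cases
      case 1
      then show ?thesis using half[of "Suc i"] by simp
    next
      case 2
      then show ?thesis using half[of "Suc i"] by simp
    next
      case 3
      \<comment> \<open>A squaring is charged to \<open>a\<close> and a contraction to
        \<open>b\<close>.\<close>
      consider "z (Suc i) \<le> (z i)\<^sup>2" | "z (Suc i) \<le> \<eta> * z i" | "z (Suc i) \<le> \<epsilon>" using step[of i] by linarith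
      then show ?thesis
      proof cases
        case 1
        have "z i \<le> max (max ((1 / 2) ^ (2 ^ a')) (\<eta> ^ b)) \<epsilon>" using Suc.prems 3 by (intro Suc.IH) auto
        from sq[OF z0(1) this] show ?thesis using 1 3 by (simp add: power2_eq_square)
      next
        case 2
        have "z i \<le> max (max ((1 / 2) ^ (2 ^ a)) (\<eta> ^ b')) \<epsilon>" using Suc.prems 3 by (intro Suc.IH) auto
        from mul[OF z0(1) this] show ?thesis using 2 3 by simp
      qed simp
    qed
  qed
  then show ?thesis by blast
qed

section \<open>Bounds on the gap\<close>

lemma prob_gap_ge:
  assumes "n > 0"
    and "measure_pmf.prob (one_plus_beta n \<beta> m) {x. \<exists>i<n. real m / n + H < x i} \<le> e"
  shows "1 - e \<le> measure_pmf.prob (one_plus_beta n \<beta> m) {x. gap n m x \<le> H}"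
proof -
  let ?P = "measure_pmf.prob (one_plus_beta n \<beta> m)"
  have "?P (- {x. gap n m x \<le> H}) \<le> ?P {x. \<exists>i<n. real m / n + H < x i}"
  proof (rule prob_mono_support)
    fix x assume "x \<in> - {x. gap n m x \<le> H}"
    then have "real m / n + H < (MAX i\<in>{..<n}. x i)" by (simp add: gap_def)
    moreover have "(MAX i\<in>{..<n}. x i) \<in> x ` {..<n}"
      using assms(1) by (intro Max_in) auto
    ultimately show "x \<in> {x. \<exists>i<n. real m / n + H < x i}" by auto
  qed
  moreover have "?P (- {x. gap n m x \<le> H}) = 1 - ?P {x. gap n m x \<le> H}"
    using measure_pmf.prob_compl[of "{x. gap n m x \<le> H}" "one_plus_beta n \<beta> m"]
    by (simp add: Compl_eq_Diff_UNIV)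
  ultimately show ?thesis using assms(2) by linarith
qed

lemma spread_if_exceeds:
  assumes "n > 0" "x \<in> set_pmf (one_plus_beta n \<beta> t)" "i < n" "real t / n + H \<le> x i"
  shows "x \<in> spread n H"
  using assms sum_loads[OF assms(1,2)] by (auto simp: spread_def norm_load_def intro!: exI[of _ i])

text \<open>The case \<open>k = 1\<close>: at \<open>H = 1000 * ln n\<close> the bound of
  \<open>prob_spread\<close> is of order \<open>n * exp (- 5 * ln n)\<close>.\<close>

lemma gap_log:
  "\<forall>\<^sub>F n in sequentially. \<forall>\<beta> m. 29 / 100 \<le> \<beta> \<and> \<beta> \<le> 1 \<longrightarrow>
     1 - real n powr (- 3) \<le> measure_pmf.prob (one_plus_beta n \<beta> m) {x. gap n m x \<le> 1000 * ln n}"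
proof -
  have "\<forall>\<^sub>F n::nat in sequentially. 2000 / 7 * n * exp (- (1000 * ln n) / 200) \<le> real n powr (- 3)"
    by real_asymp
  moreover have "\<forall>\<^sub>F n::nat in sequentially. n > 0" by (rule eventually_gt_at_top)
  ultimately show ?thesis
  proof eventually_elim
    case (elim n)
    show ?case
    proof (intro allI impI prob_gap_ge elim(2))
      fix \<beta> :: real and m assume \<beta>: "29 / 100 \<le> \<beta> \<and> \<beta> \<le> 1"
      have "measure_pmf.prob (one_plus_beta n \<beta> m) {x. \<exists>i<n. real m / n + 1000 * ln n < x i}
         \<le> measure_pmf.prob (one_plus_beta n \<beta> m) (spread n (1000 * ln n))"
        by (rule prob_mono_support) (auto intro: spread_if_exceeds[OF elim(2)] less_imp_le)
      also have "\<dots> \<le> 2000 / 7 * n * exp (- (1000 * ln n) / 200)" using \<beta> elim(2) by (intro prob_spread) auto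
      finally show "measure_pmf.prob (one_plus_beta n \<beta> m) {x. \<exists>i<n. real m / n + 1000 * ln n < x i}
         \<le> real n powr (- 3)" using elim(1) by linarith
    qed
  qed
qed

text \<open>The bounds \<open>\<nu> i / n\<close> of \<open>layers\<close>, with its recursion taken
  as an equality for \<open>T = n * l\<close> and \<open>e = 10 * ln n / n\<close>. The initial
  value becomes \<open>1 / 2\<close> when scaled by \<open>8 * l\<close>, as
  \<open>squaring_or_contracting\<close> asks.\<close>

primrec layer_frac :: "nat \<Rightarrow> real \<Rightarrow> real \<Rightarrow> nat \<Rightarrow> real" where
  "layer_frac l \<delta> e 0 = 1 / (16 * real l)"
| "layer_frac l \<delta> e (Suc i) = 2 * real l * ((layer_frac l \<delta> e i)\<^sup>2 + \<delta> * layer_frac l \<delta> e i) + e"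

lemma layer_frac_nonneg: "0 \<le> \<delta> \<Longrightarrow> 0 \<le> e \<Longrightarrow> 0 \<le> layer_frac l \<delta> e i"
  by (induction i) auto

text \<open>Scaled by \<open>8 * l\<close> the recursion reads
  \<open>z\<^sup>2 / 4 + \<eta> * z / 4 + \<epsilon> / 2\<close> with
  \<open>\<eta> = 8 * l * \<delta>\<close> and \<open>\<epsilon> = 16 * l * e\<close>. The weights
  add up to 1, so the largest of the three dominates.\<close>

lemma layer_frac_bound:
  assumes "0 \<le> \<delta>" "0 \<le> e" "l > 0" "8 * real l * \<delta> \<le> 1" "16 * real l * e \<le> 1 / 2"
  shows "8 * real l * layer_frac l \<delta> e (a + b)
    \<le> max (max ((1 / 2) ^ (2 ^ a)) ((8 * real l * \<delta>) ^ b)) (16 * real l * e)"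
proof -
  define z where "z = (\<lambda>i. 8 * real l * layer_frac l \<delta> e i)"
  have z0: "0 \<le> z i" for i using assms by (simp add: z_def layer_frac_nonneg)
  have "z (Suc i) \<le> max (max ((z i)\<^sup>2) ((8 * real l * \<delta>) * z i)) (16 * real l * e)" for i
  proof -
    have "z (Suc i) = (z i)\<^sup>2 / 4 + (8 * real l * \<delta>) * z i / 4 + 8 * real l * e"
      using assms(3) by (simp add: z_def field_simps power2_eq_square)
    moreover have "0 \<le> (z i)\<^sup>2" "0 \<le> (8 * real l * \<delta>) * z i" using assms z0 by simp_all
    ultimately show ?thesis by linarith
  qed
  then have "z (a + b) \<le> max (max ((1 / 2) ^ (2 ^ a)) ((8 * real l * \<delta>) ^ b)) (16 * real l * e)"
    using assms z0 by (intro squaring_or_contracting) (auto simp: z_def)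
  then show ?thesis by (simp add: z_def)
qed

lemma heavy_exp_le_potential:
  assumes "\<alpha> \<ge> 0" "\<And>i. i < n \<Longrightarrow> h \<le> x i \<Longrightarrow> w \<le> norm_load n x i"
  shows "real (heavy n h x) * exp (\<alpha> * w) \<le> potential \<alpha> n x"
proof -
  have "real (heavy n h x) * exp (\<alpha> * w) = (\<Sum>i\<in>{i\<in>{..<n}. h \<le> x i}. exp (\<alpha> * w))"
    by (simp add: heavy_def)
  also have "\<dots> \<le> (\<Sum>i\<in>{i\<in>{..<n}. h \<le> x i}. exp (\<alpha> * norm_load n x i))"
    using assms by (intro sum_mono) (auto intro: mult_left_mono)
  also have "\<dots> \<le> pot \<alpha> n x" unfolding pot_def by (intro sum_mono2) auto
  finally show ?thesis using pot_nonneg[of "- \<alpha>" n x] by (simp add: potential_def)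
qed

text \<open>A contraction gains a factor \<open>exp (- (3 / 10 * E))\<close>, and
  \<open>D * E = ln n\<close>, so a multiple of \<open>D\<close> contractions gains any fixed power
  of \<open>n\<close>. The restriction to \<open>k \<ge> 2\<close> makes \<open>E\<close> at least
  \<open>sqrt (ln n)\<close>, so that powers of \<open>ln n\<close> are negligible against
  \<open>exp E\<close>.\<close>

lemma gap_layers:
  "\<forall>\<^sub>F n in sequentially. \<forall>(k::nat) (\<beta>::real) m. 2 \<le> k \<and> real k \<le> kappa * ln (ln n) \<and> \<beta> \<le> 1 \<and>
     \<beta> \<ge> 1 - 2 powr (- 0.5 * ln n powr ((real k - 1) / real k)) \<longrightarrow>
     1 - real n powr (- 3) \<le> measure_pmf.prob (one_plus_beta n \<beta> m)
        {x. gap n m x \<le> 1000 * real k * ln n powr (1 / real k)}"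
proof -
  \<comment> \<open>The summands are the failure probabilities of the potential bound, of the spread
    bound at the start of the window, and of the layers together with the top.\<close>
  have "\<forall>\<^sub>F n::nat in sequentially. 1 / real n ^ 4 + 2000 / 7 / real n ^ 9 + (10 * ln n + 10) / real n ^ 6 \<le> real n powr (- 3)"
    by real_asymp
  moreover have "\<forall>\<^sub>F n::nat in sequentially. 10 ^ 6 * ln n ^ 3 \<le> exp (sqrt (ln n) / 30)"
    by real_asymp
  moreover have "\<forall>\<^sub>F n::nat in sequentially. 16 * 2001 * (6 * 10 ^ 6) \<le> ln n"
    by real_asymp
  moreover have "\<forall>\<^sub>F n::nat in sequentially. 10 ^ 6 * ln n ^ 2 \<le> n"
    by real_asymp
  moreover have "\<forall>\<^sub>F n::nat in sequentially. n > 0" by (rule eventually_gt_at_top)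
  ultimately show ?thesis using potential_concentration
  proof eventually_elim
    case (elim n)
    define L where "L = ln (real n)"
    have n0: "n > 0" and nr: "real n > 0" using elim(5) by auto
    have L_large: "16 * 2001 * (6 * 10 ^ 6) \<le> L" using elim(3) by (simp add: L_def)
    have L1: "L \<ge> 1" using L_large by simp
    have nexp: "real n = exp L" using nr by (simp add: L_def)
    show ?case
    proof (intro allI impI prob_gap_ge[OF n0])
      fix k :: nat and \<beta> :: real and m :: nat
      assume asm: "2 \<le> k \<and> real k \<le> kappa * ln (ln n) \<and> \<beta> \<le> 1 \<and>
        \<beta> \<ge> 1 - 2 powr (- 0.5 * ln n powr ((real k - 1) / real k))"
      define D where "D = L powr (1 / k)"
      define E where "E = L powr ((real k - 1) / k)"
      define \<delta> where "\<delta> = 2 powr (- 0.5 * E)"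
      have k2: "real k \<ge> 2" using asm by simp
      have lnD: "ln L = k * ln D" using k2 L1 by (simp add: D_def ln_powr)
      \<comment> \<open>Here \<open>kappa\<close> enters: \<open>k \<le> kappa * ln L\<close> says
        that \<open>ln D = ln L / k\<close> is at least \<open>ln (10 ^ 4)\<close>.\<close>
      have D4: "D \<ge> 10 ^ 4"
      proof -
        have "real k * ln (10 ^ 4) \<le> ln L"
          using asm by (simp add: kappa_def L_def field_simps)
        then have "ln (10 ^ 4) \<le> ln D" using k2 unfolding lnD by (subst (asm) mult_le_cancel_left_pos) auto
        then show ?thesis using L1 by (subst (asm) ln_le_cancel_iff) (auto simp: D_def)
      qed
      have DE: "D * E = L"
      proof -
        have "1 / real k + (real k - 1) / real k = 1" using k2 by (simp add: field_simps)
        then show ?thesis using L1 by (simp add: D_def E_def flip: powr_add)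
      qed
      have E_sqrt: "sqrt L \<le> E"
      proof -
        have "L powr (1 / 2) \<le> L powr ((real k - 1) / k)"
          using L1 k2 by (intro powr_mono) (auto simp: field_simps)
        then show ?thesis using L1 by (simp add: E_def powr_half_sqrt)
      qed
      then have E1: "E \<ge> 1" using real_sqrt_ge_one[OF L1] by linarith
      have DL: "D \<le> L" using mult_left_mono[OF E1, of D] D4 by (simp add: DE)
      have EL: "E \<le> L" using mult_right_mono[of 1 D E] D4 E1 by (simp add: DE)
      have \<delta>0: "0 \<le> \<delta>" by (simp add: \<delta>_def)
      have \<delta>E: "\<delta> \<le> exp (- (E / 3))"
      proof -
        have "(E / 2) * (2 / 3) \<le> (E / 2) * ln 2" using ln2_ge_two_thirds E1 by (intro mult_left_mono) auto
        then show ?thesis by (simp add: \<delta>_def powr_def)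
      qed
      have big: "10 ^ 6 * L ^ 3 * exp (- (E / 3)) \<le> exp (- (3 / 10 * E))"
      proof -
        have "10 ^ 6 * L ^ 3 \<le> exp (sqrt L / 30)" using elim(2) by (simp add: L_def)
        also have "\<dots> \<le> exp (E / 30)" using E_sqrt by simp
        finally have "10 ^ 6 * L ^ 3 * exp (- (E / 3)) \<le> exp (E / 30) * exp (- (E / 3))"
          by (intro mult_right_mono) auto
        then show ?thesis by (simp flip: exp_add)
      qed
      have \<beta>: "1 - \<beta> \<le> \<delta>" "\<beta> \<le> 1" using asm by (auto simp: \<delta>_def E_def L_def)
      have "29 / 100 \<le> \<beta>"
      proof -
        have "10 ^ 6 * exp (- (E / 3)) \<le> 10 ^ 6 * L ^ 3 * exp (- (E / 3))"
          using L1 by (intro mult_right_mono) auto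
        also have "\<dots> \<le> exp 0" using E1 by (intro order_trans[OF big]) simp
        finally show ?thesis using \<beta>(1) \<delta>E by simp
      qed
      note \<beta> = \<beta> this

      \<comment> \<open>The window of \<open>n * l\<close> balls raises the average by
        \<open>l\<close>, so a load that initially exceeds its average by less than \<open>l\<close>
        is below the final average. As \<open>l \<ge> 2000 * L\<close>, exceptions have probability
        of order \<open>1 / n ^ 9\<close>.\<close>
      define l where "l = nat \<lceil>2000 * L\<rceil>"
      have l: "2000 * L \<le> l" "real l \<le> 2001 * L" "l > 0" using L1 unfolding l_def by linarith+
      define e where "e = 10 * L / n"
      have e0: "0 \<le> e" using L1 by (simp add: e_def)
      \<comment> \<open>Since \<open>16000 / 8000 = 2\<close>, each bin of load \<open>h\<close>
        adds at least \<open>L\<^sup>2\<close> to the potential; so at most a fraction of order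
        \<open>1 / L\<^sup>2\<close> reaches \<open>h\<close>, less than the initial
        \<open>1 / (16 * l)\<close>.\<close>
      define h where "h = nat \<lceil>real m / n + 16000 * ln L\<rceil>"
      have lnL: "ln L \<ge> 0" using L1 by simp
      have h: "real m / n + 16000 * ln L \<le> h" "h \<le> real m / n + 16000 * ln L + 1"
      proof -
        have "0 \<le> real m / n + 16000 * ln L" using lnL by (intro add_nonneg_nonneg) auto
        then show "real m / n + 16000 * ln L \<le> h" "h \<le> real m / n + 16000 * ln L + 1"
          unfolding h_def by linarith+
      qed
      \<comment> \<open>The choices make \<open>(1 / 2) ^ (2 ^ a)\<close> and
        \<open>exp (- (3 / 10 * E)) ^ b\<close> at most \<open>1 / n\<close>, and
        \<open>Q ^ r\<close> at most \<open>1 / n ^ 6\<close>.\<close>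
      define a where "a = nat \<lceil>log 2 (2 * L)\<rceil>"
      define b where "b = nat \<lceil>4 * D\<rceil>"
      define r where "r = nat \<lceil>20 * D\<rceil>"
      define \<nu> where "\<nu> = (\<lambda>i. n * layer_frac l \<delta> e i)"
      define Q where "Q = exp (- (3 / 10 * E))"
      have loga: "log 2 (2 * L) \<le> 1 + 3 / 2 * ln L"
      proof -
        have "(2 / 3) * ln L \<le> ln 2 * ln L" using ln2_ge_two_thirds lnL by (intro mult_right_mono) auto
        then show ?thesis using L1 by (simp add: log_def ln_mult field_simps)
      qed
      have a: "log 2 (2 * L) \<le> a" "a \<le> 2 + 3 / 2 * ln L"
      proof -
        have "0 \<le> log 2 (2 * L)" using L1 by simp
        then show "log 2 (2 * L) \<le> a" "a \<le> 2 + 3 / 2 * ln L" using loga unfolding a_def by linarith+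
      qed
      have D1: "D \<ge> 1" using D4 by simp
      have b: "4 * D \<le> b" "b \<le> 4 * D + 1" and r: "20 * D \<le> r" "r \<le> 20 * D + 1"
        using D1 unfolding b_def r_def by linarith+

      have \<eta>: "8 * real l * \<delta> \<le> exp (- (3 / 10 * E))"
      proof -
        have "8 * real l * \<delta> \<le> (8 * (2001 * L)) * exp (- (E / 3))"
          using l \<delta>E \<delta>0 L1 by (intro mult_mono) auto
        also have "\<dots> \<le> 10 ^ 6 * L ^ 3 * exp (- (E / 3))"
          using L1 self_le_power[of L 3] by (intro mult_right_mono) auto
        finally show ?thesis using big by linarith
      qed
      have e_small: "16 * real l * e \<le> 1 / 2"
      proof -
        have "16 * real l * e \<le> 16 * (2001 * L) * e" using l e0 by (intro mult_mono) auto
        also have "\<dots> \<le> 1 / 2" using elim(4) nr by (simp add: e_def L_def power2_eq_square field_simps)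
        finally show ?thesis .
      qed
      \<comment> \<open>After squarings and contractions only the additive term \<open>e\<close> of
        the recursion matters, which stands for \<open>20 * L\<close> bins.\<close>
      have frac: "layer_frac l \<delta> e (a + b) \<le> 20 * L / n"
      proof -
        have "8 * real l * \<delta> \<le> 1" using \<eta> E1 exp_le_one_iff[of "- (3 / 10 * E)"] by linarith
        then have "8 * real l * layer_frac l \<delta> e (a + b)
            \<le> max (max ((1 / 2) ^ (2 ^ a)) ((8 * real l * \<delta>) ^ b)) (16 * real l * e)"
          using \<delta>0 e0 l(3) e_small by (intro layer_frac_bound) auto
        also have "\<dots> \<le> 16 * real l * e"
        proof (intro max.boundedI order_refl)
          have "exp (- L) = 1 / n" by (simp add: nexp exp_minus divide_simps)
          also have "\<dots> \<le> 16 * real l * e"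
          proof -
            have "1 * 1 \<le> (16 * real l) * (10 * L)" using l L1 by (intro mult_mono) auto
            then show ?thesis using nr by (simp add: e_def field_simps)
          qed
          finally have small: "exp (- L) \<le> 16 * real l * e" .
          have "2 * L = 2 powr (log 2 (2 * L))" using L1 by simp
          also have "\<dots> \<le> 2 powr (real a)" using a(1) by (intro powr_mono) auto
          finally have "2 * L \<le> 2 ^ a" by (simp add: powr_realpow)
          then have "2 * L * (2 / 3) \<le> 2 ^ a * ln 2" using ln2_ge_two_thirds L1 by (intro mult_mono) auto
          then have "L \<le> real (2 ^ a) * ln 2" using L1 by simp
          then have "exp (real (2 ^ a) * - ln 2) \<le> exp (- L)" by simp
          moreover have "exp (real (2 ^ a) * - ln 2) = (1 / 2) ^ (2 ^ a)"
            unfolding exp_of_nat_mult by (simp add: exp_minus inverse_eq_divide)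
          ultimately show "(1 / 2) ^ (2 ^ a) \<le> 16 * real l * e" using small by linarith
          have "(8 * real l * \<delta>) ^ b \<le> exp (- (3 / 10 * E)) ^ b"
            using \<eta> \<delta>0 by (intro power_mono) auto
          also have "\<dots> = exp (- (3 / 10 * (b * E)))" by (simp add: mult_ac flip: exp_of_nat_mult)
          also have "\<dots> \<le> exp (- L)"
          proof -
            have "4 * D * E \<le> b * E" using b E1 by (intro mult_right_mono) auto
            then have "4 * L \<le> b * E" by (simp only: mult.assoc DE)
            then show ?thesis using L1 by (simp add: mult_ac)
          qed
          finally show "(8 * real l * \<delta>) ^ b \<le> 16 * real l * e" using small by linarith
        qed
        also have "\<dots> = 8 * real l * (20 * L / n)" by (simp add: e_def)
        finally show ?thesis using l(3) by (subst (asm) mult_le_cancel_left_pos) auto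
      qed
      have frac0: "0 \<le> layer_frac l \<delta> e i" for i using \<delta>0 e0 by (rule layer_frac_nonneg)
      \<comment> \<open>\<open>Q\<close> bounds the expected number of balls that the window drops
        onto these last bins: \<open>L ^ 3 / n\<close> from the square and
        \<open>L\<^sup>2 * \<delta>\<close> from single choices, up to constants.\<close>
      have Q: "((\<nu> (a + b) / n)\<^sup>2 + \<delta> * (\<nu> (a + b) / n)) * (real n * l) \<le> Q" "0 < Q" "Q \<le> 1"
      proof -
        let ?p = "layer_frac l \<delta> e (a + b)"
        have "(?p\<^sup>2 + \<delta> * ?p) * (real n * l) \<le> ((20 * L / n)\<^sup>2 + exp (- (E / 3)) * (20 * L / n)) * (real n * (2001 * L))"
          using frac frac0 \<delta>0 \<delta>E l L1 by (intro mult_mono add_mono power_mono) auto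
        also have "\<dots> = 2001 * (400 * L ^ 3 * (1 / n) + 20 * L\<^sup>2 * exp (- (E / 3)))"
          using nr by (simp add: field_simps power2_eq_square power3_eq_cube)
        also have "\<dots> \<le> 2001 * (400 * L ^ 3 * exp (- (E / 3)) + 20 * L ^ 3 * exp (- (E / 3)))"
        proof -
          have "1 / real n = exp (- L)" by (simp add: nexp exp_minus divide_simps)
          then have "1 / real n \<le> exp (- (E / 3))" using EL E1 by simp
          moreover have "L\<^sup>2 \<le> L ^ 3" using L1 by (intro power_increasing) auto
          ultimately show ?thesis using L1 by (intro mult_left_mono add_mono mult_right_mono) auto
        qed
        also have "\<dots> = 840420 * (L ^ 3 * exp (- (E / 3)))" by simp
        also have "\<dots> \<le> 10 ^ 6 * (L ^ 3 * exp (- (E / 3)))" using L1 by (intro mult_right_mono) auto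
        also have "\<dots> \<le> Q" using big by (simp add: Q_def mult_ac)
        finally show "((\<nu> (a + b) / n)\<^sup>2 + \<delta> * (\<nu> (a + b) / n)) * (real n * l) \<le> Q"
          using nr by (simp add: \<nu>_def)
        show "0 < Q" "Q \<le> 1" using E1 by (auto simp: Q_def)
      qed
      have Qr: "Q ^ r \<le> 1 / real n ^ 6"
      proof -
        have "Q ^ r = exp (- (3 / 10 * (r * E)))" by (simp add: Q_def mult_ac flip: exp_of_nat_mult)
        also have "\<dots> \<le> exp (- (6 * L))"
        proof -
          have "20 * D * E \<le> r * E" using r E1 by (intro mult_right_mono) auto
          then have "20 * L \<le> r * E" by (simp only: mult.assoc DE)
          then show ?thesis by (simp add: mult_ac)
        qed
        also have "\<dots> = 1 / real n ^ 6" by (simp add: nexp exp_minus divide_simps flip: exp_of_nat_mult)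
        finally show ?thesis .
      qed

      let ?F = "{y. \<exists>i<n. h + (a + b) + r \<le> y i}"
      let ?H = "{y. \<nu> 0 < heavy n h y}"
      have window: "measure_pmf.prob (walk n \<beta> t x) ?F
          \<le> measure_pmf.prob (walk n \<beta> t x) ?H + real (a + b) / real n ^ 6 + 3 * (1 / real n ^ 6)"
        if "\<And>i. i < n \<Longrightarrow> x i \<le> h" "t \<le> n * l" for x t
      proof -
        have "real t \<le> real n * l" using that(2) by (metis of_nat_le_iff of_nat_mult)
        then have "measure_pmf.prob (walk n \<beta> t x) ?F
          \<le> measure_pmf.prob (walk n \<beta> t x) ?H + real (a + b) / real n ^ 6 + 3 * Q ^ r"
          using n0 \<beta> that(1) Q nr \<delta>0 e0
          by (intro prob_window[where T = "real n * l" and \<delta> = \<delta>])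
            (auto simp: \<nu>_def layer_frac_nonneg e_def L_def field_simps)
        then show ?thesis using Qr by linarith
      qed
      obtain s t where st: "m = s + t" "t \<le> n * l" "s = 0 \<or> t = n * l"
      proof (cases "m \<le> n * l")
        case True
        then show ?thesis using that[of 0 m] by simp
      next
        case False
        then show ?thesis using that[of "m - n * l" "n * l"] by simp
      qed
      have int: "integrable (measure_pmf (one_plus_beta n \<beta> s)) f" for f :: "loads \<Rightarrow> real"
        by (rule integrable_measure_pmf_finite[OF finite_one_plus_beta[OF n0]])
      have "measure_pmf.prob (one_plus_beta n \<beta> m) ?F
        = measure_pmf.expectation (one_plus_beta n \<beta> s) (\<lambda>x. measure_pmf.prob (walk n \<beta> t x) ?F)"
        unfolding st(1) by (rule prob_one_plus_beta_add[OF n0])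
      also have "\<dots> \<le> measure_pmf.expectation (one_plus_beta n \<beta> s) (\<lambda>x. indicator (spread n l) x
          + (measure_pmf.prob (walk n \<beta> t x) ?H + real (a + b) / real n ^ 6 + 3 * (1 / real n ^ 6)))"
      proof (intro expectation_mono_finite finite_one_plus_beta n0)
        fix x assume x: "x \<in> set_pmf (one_plus_beta n \<beta> s)"
        show "measure_pmf.prob (walk n \<beta> t x) ?F \<le> indicator (spread n l) x
          + (measure_pmf.prob (walk n \<beta> t x) ?H + real (a + b) / real n ^ 6 + 3 * (1 / real n ^ 6))"
        proof (cases "x \<in> spread n l")
          case True
          have "measure_pmf.prob (walk n \<beta> t x) ?F \<le> 1" by simp
          moreover have "0 \<le> measure_pmf.prob (walk n \<beta> t x) ?H + real (a + b) / real n ^ 6 + 3 * (1 / real n ^ 6)"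
            by (intro add_nonneg_nonneg) auto
          ultimately show ?thesis using True by (simp only: indicator_simps)
        next
          case False
          have "x i \<le> h" if i: "i < n" for i
          proof (cases "s = 0")
            case True
            then show ?thesis using x by simp
          next
            case s: False
            have "real (x i) \<le> real s / n + l"
              using spread_if_exceeds[OF n0 x i, of l] False by linarith
            also have "\<dots> = real m / n" using s st nr by (simp add: field_simps)
            also have "\<dots> \<le> h" using h(1) lnL by linarith
            finally show ?thesis by simp
          qed
          from window[OF this st(2)] show ?thesis using False by simp
        qed
      qed
      also have "\<dots> = measure_pmf.prob (one_plus_beta n \<beta> s) (spread n l)
          + (measure_pmf.prob (one_plus_beta n \<beta> m) ?H + real (a + b) / real n ^ 6 + 3 * (1 / real n ^ 6))"
        unfolding st(1) prob_one_plus_beta_add[OF n0] by (simp add: int)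
      also have "measure_pmf.prob (one_plus_beta n \<beta> s) (spread n l) \<le> 2000 / 7 / real n ^ 9"
      proof -
        have "measure_pmf.prob (one_plus_beta n \<beta> s) (spread n l) \<le> 2000 / 7 * n * exp (- real l / 200)"
          using n0 \<beta> by (intro prob_spread) auto
        also have "\<dots> \<le> 2000 / 7 * n * exp (- (10 * L))" using l(1) by (intro mult_left_mono) auto
        also have "exp (- (10 * L)) = 1 / real n ^ 10"
          by (simp add: nexp exp_minus divide_simps flip: exp_of_nat_mult)
        also have "2000 / 7 * n * (1 / real n ^ 10) = 2000 / 7 / real n ^ 9"
          using nr by (simp add: field_simps power_eq_if)
        finally show ?thesis .
      qed
      also have "measure_pmf.prob (one_plus_beta n \<beta> m) ?H \<le> 1 / real n ^ 4"
      proof -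
        have "measure_pmf.prob (one_plus_beta n \<beta> m) ?H
           \<le> measure_pmf.prob (one_plus_beta n \<beta> m) {x. 6 * 10 ^ 6 * real n \<le> potential (1 / 8000) n x}"
        proof (rule prob_mono_support)
          fix x assume x: "x \<in> set_pmf (one_plus_beta n \<beta> m)" "x \<in> ?H"
          have "exp (1 / 8000 * (16000 * ln L)) = L\<^sup>2"
            using L1 exp_of_nat_mult[of 2 "ln L"] by simp
          moreover have "16000 * ln L \<le> norm_load n x i" if "i < n" "h \<le> x i" for i
          proof -
            have "real h \<le> x i" using that(2) by simp
            then show ?thesis using h(1) sum_loads[OF n0 x(1)] by (simp add: norm_load_def)
          qed
          ultimately have "real (heavy n h x) * L\<^sup>2 \<le> potential (1 / 8000) n x"
            using heavy_exp_le_potential[of "1 / 8000" n h x "16000 * ln L"] by simp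
          moreover have "\<nu> 0 * L\<^sup>2 \<le> real (heavy n h x) * L\<^sup>2"
            using x(2) by (intro mult_right_mono) auto
          moreover have "6 * 10 ^ 6 * real n \<le> \<nu> 0 * L\<^sup>2"
          proof -
            have "6 * 10 ^ 6 * (16 * real l) \<le> 6 * 10 ^ 6 * (16 * (2001 * L))" using l(2) by simp
            also have "\<dots> \<le> L * L" using mult_right_mono[OF L_large, of L] L1 by simp
            finally have "6 * 10 ^ 6 \<le> L\<^sup>2 / (16 * real l)" using l(3) by (simp add: field_simps power2_eq_square)
            then have "real n * (6 * 10 ^ 6) \<le> n * (L\<^sup>2 / (16 * real l))" by (intro mult_left_mono) auto
            then show ?thesis by (simp add: \<nu>_def mult_ac)
          qed
          ultimately show "x \<in> {x. 6 * 10 ^ 6 * real n \<le> potential (1 / 8000) n x}" by simp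
        qed
        then show ?thesis using elim(6) \<beta> by (meson order_trans)
      qed
      also have "real (a + b) / real n ^ 6 \<le> (10 * L + 7) / real n ^ 6"
        using a(2) b(2) DL ln_le_minus_one[of L] L1 by (intro divide_right_mono) auto
      finally have F: "measure_pmf.prob (one_plus_beta n \<beta> m) ?F \<le> real n powr (- 3)"
        using elim(1) by (simp add: L_def add_divide_distrib)
      \<comment> \<open>As \<open>ln D \<le> D / 50\<close>, the term
        \<open>16000 * ln L = 16000 * k * ln D\<close> takes 320 of the 1000; \<open>b + r\<close>,
        about \<open>24 * D\<close>, takes about 12 more because \<open>k \<ge> 2\<close>.\<close>
      have height: "16000 * ln L + 1 + (real a + real b) + r \<le> 1000 * k * D"
      proof -
        have "ln D = 2 * ln (sqrt D)" using D4 by (simp add: ln_sqrt)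
        also have "\<dots> \<le> 2 * sqrt D" using D4 ln_le_minus_one[of "sqrt D"] by simp
        also have "\<dots> \<le> 2 * (D / 100)"
        proof -
          have "100 \<le> sqrt D" using D4 by (intro real_le_rsqrt) simp
          then have "100 * sqrt D \<le> sqrt D * sqrt D" using D1 by (intro mult_right_mono) auto
          then show ?thesis using D1 by simp
        qed
        finally have "k * ln D \<le> k * (D / 50)" by (intro mult_left_mono) auto
        then have "ln L \<le> k * D / 50" by (simp add: lnD)
        moreover have "2 * D \<le> k * D" using k2 D4 by (intro mult_right_mono) auto
        ultimately show ?thesis using a(2) b(2) r(2) D1 by linarith
      qed
      have "measure_pmf.prob (one_plus_beta n \<beta> m) {x. \<exists>i<n. real m / n + 1000 * real k * ln n powr (1 / real k) < x i}
         \<le> measure_pmf.prob (one_plus_beta n \<beta> m) ?F"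
      proof (rule prob_mono_support)
        fix x :: loads
        assume "x \<in> {x. \<exists>i<n. real m / n + 1000 * real k * ln n powr (1 / real k) < real (x i)}"
        then obtain i where i: "i < n" "real m / n + 1000 * k * D < x i" by (auto simp: D_def L_def)
        then have "real (h + (a + b) + r) \<le> real (x i)" using height h(2) by simp
        then show "x \<in> ?F" using i(1) by (auto simp only: of_nat_le_iff)
      qed
      then show "measure_pmf.prob (one_plus_beta n \<beta> m)
          {x. \<exists>i<n. real m / n + 1000 * real k * ln n powr (1 / real k) < x i} \<le> real n powr (- 3)"
        using F by linarith
    qed
  qed
qed

lemma gap_k:
  "\<forall>\<^sub>F n in sequentially. \<forall>(k::nat) (\<beta>::real) m. 1 \<le> k \<and> real k \<le> kappa * ln (ln n) \<and> \<beta> \<le> 1 \<and>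
     \<beta> \<ge> 1 - 2 powr (- 0.5 * ln n powr ((real k - 1) / real k)) \<longrightarrow>
     1 - real n powr (- 3) \<le> measure_pmf.prob (one_plus_beta n \<beta> m)
        {x. gap n m x \<le> 1000 * real k * ln n powr (1 / real k)}"
proof -
  have "\<forall>\<^sub>F n::nat in sequentially. 0 < ln n" by real_asymp
  with gap_log gap_layers show ?thesis
  proof eventually_elim
    case (elim n)
    show ?case
    proof (intro allI impI)
      fix k :: nat and \<beta> :: real and m :: nat
      assume asm: "1 \<le> k \<and> real k \<le> kappa * ln (ln n) \<and> \<beta> \<le> 1 \<and>
        \<beta> \<ge> 1 - 2 powr (- 0.5 * ln n powr ((real k - 1) / real k))"
      show "1 - real n powr (- 3) \<le> measure_pmf.prob (one_plus_beta n \<beta> m)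
        {x. gap n m x \<le> 1000 * real k * ln n powr (1 / real k)}"
      proof (cases "k = 1")
        case True
        \<comment> \<open>At \<open>k = 1\<close> the threshold for \<open>\<beta>\<close> is
          \<open>1 - 2 powr (- 1 / 2)\<close>. This needs \<open>ln n\<close> to be nonzero, because
          \<open>0 powr 0 = 0\<close>.\<close>
        have "2 powr (- (1 / 2)) = 1 / sqrt (2::real)"
          by (simp add: powr_minus powr_half_sqrt divide_simps)
        also have "\<dots> \<le> 71 / 100"
        proof -
          have "100 / 71 \<le> sqrt (2::real)" by (rule real_le_rsqrt) (simp add: power2_eq_square)
          then show ?thesis by (simp add: divide_simps)
        qed
        finally have "29 / 100 \<le> \<beta>" using asm True elim(3) by simp
        then show ?thesis using elim(1,3) asm True by simp
      next
        case False
        then show ?thesis using elim(2) asm by auto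
      qed
    qed
  qed
qed

text \<open>For \<open>k\<close> about \<open>\<epsilon> * ln (ln n)\<close> the power
  \<open>ln n powr (1 / k)\<close> lies between \<open>exp d\<close> and \<open>exp (2 * d)\<close>,
  so the bound of \<open>gap_k\<close> is of order \<open>k\<close>. The choice of \<open>d\<close>
  ensures \<open>\<epsilon> \<le> kappa\<close>, and \<open>exp (- d) \<le> c\<^sub>1\<close> brings
  \<open>ln n powr ((k - 1) / k)\<close> below \<open>c\<^sub>1 * ln n\<close>, so that
  \<open>\<beta>\<close> qualifies.\<close>

lemma gap_loglog:
  fixes c\<^sub>1 :: real
  assumes "c\<^sub>1 > 0"
  shows "\<exists>c\<^sub>2>0. \<forall>\<^sub>F n in sequentially. \<forall>\<beta> m. \<beta> \<le> 1 \<and> \<beta> \<ge> 1 - real n powr (- c\<^sub>1) \<longrightarrow>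
    1 - real n powr (- 3) \<le> measure_pmf.prob (one_plus_beta n \<beta> m) {x. gap n m x \<le> c\<^sub>2 * ln (ln n)}"
proof -
  define d where "d = max (ln (10 ^ 4)) (ln (1 / c\<^sub>1))"
  define \<epsilon> where "\<epsilon> = 1 / d"
  have "ln (10 ^ 4 :: real) > 0" by simp
  then have d0: "d > 0" unfolding d_def by linarith
  have \<epsilon>: "0 < \<epsilon>" "\<epsilon> \<le> kappa"
    using d0 by (auto simp: \<epsilon>_def kappa_def d_def intro!: divide_left_mono)
  have dc: "exp (- d) \<le> c\<^sub>1"
  proof -
    have "ln (1 / c\<^sub>1) \<le> d" by (simp add: d_def)
    then have "- d \<le> ln c\<^sub>1" using assms by (simp add: ln_div)
    then show ?thesis using assms by (metis exp_le_cancel_iff exp_ln)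
  qed
  define c\<^sub>2 where "c\<^sub>2 = 1000 * \<epsilon> * exp (2 * d)"
  have "\<forall>\<^sub>F n::nat in sequentially. d \<le> ln (ln n)" by real_asymp
  moreover have "\<forall>\<^sub>F n::nat in sequentially. 1 \<le> ln n" by real_asymp
  ultimately have "\<forall>\<^sub>F n in sequentially. \<forall>\<beta> m. \<beta> \<le> 1 \<and> \<beta> \<ge> 1 - real n powr (- c\<^sub>1) \<longrightarrow>
    1 - real n powr (- 3) \<le> measure_pmf.prob (one_plus_beta n \<beta> m) {x. gap n m x \<le> c\<^sub>2 * ln (ln n)}"
    using gap_k
  proof eventually_elim
    case (elim n)
    define L where "L = ln (real n)"
    have L1: "L \<ge> 1" and Ld: "d \<le> ln L" using elim by (auto simp: L_def)
    have n0: "real n > 0" using elim(2) by (cases "n = 0") auto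
    define k where "k = nat \<lfloor>\<epsilon> * ln L\<rfloor>"
    have "1 \<le> \<epsilon> * ln L" using Ld d0 by (simp add: \<epsilon>_def field_simps)
    then have "1 \<le> \<lfloor>\<epsilon> * ln L\<rfloor>" by (simp add: le_floor_iff)
    \<comment> \<open>A floor that is at least 1 loses less than a factor of 2.\<close>
    then have k: "1 \<le> k" "real k \<le> \<epsilon> * ln L" "\<epsilon> * ln L \<le> 2 * real k"
      unfolding k_def by linarith+
    have dk: "d * real k \<le> ln L" "ln L \<le> 2 * d * real k"
      using k(2,3) d0 by (auto simp: \<epsilon>_def field_simps)
    have kappa: "real k \<le> kappa * ln L"
      using k(2) mult_right_mono[OF \<epsilon>(2), of "ln L"] L1 by simp
    have delta: "real n powr (- c\<^sub>1) \<le> 2 powr (- 0.5 * L powr ((real k - 1) / real k))"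
    proof -
      have "(real k - 1) / real k * ln L = ln L - ln L / k" using k(1) by (simp add: field_simps)
      then have "L powr ((real k - 1) / real k) = exp (ln L - ln L / k)"
        using L1 by (simp add: powr_def)
      also have "\<dots> = L * exp (- (ln L / k))" using L1 unfolding diff_conv_add_uminus exp_add by simp
      also have "\<dots> \<le> L * exp (- d)"
        using dk(1) k(1) L1 by (intro mult_left_mono) (auto simp: field_simps)
      also have "\<dots> \<le> L * c\<^sub>1" using dc L1 by (intro mult_left_mono) auto
      finally have E: "L powr ((real k - 1) / real k) \<le> L * c\<^sub>1" .
      have "L powr ((real k - 1) / real k) * (ln 2 / 2) \<le> L powr ((real k - 1) / real k) * 1"
        using ln_le_minus_one[of "2::real"] by (intro mult_left_mono) auto
      then have "L powr ((real k - 1) / real k) * (ln 2 / 2) \<le> L * c\<^sub>1" using E by linarith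
      then show ?thesis using n0 by (simp add: powr_def L_def mult_ac)
    qed
    have sub: "{x. gap n m x \<le> 1000 * real k * L powr (1 / real k)} \<subseteq> {x. gap n m x \<le> c\<^sub>2 * ln L}" for m
    proof -
      have "L powr (1 / real k) = exp (ln L / k)" using L1 by (simp add: powr_def)
      also have "\<dots> \<le> exp (2 * d)" using dk(2) k(1) by (simp add: field_simps)
      finally have "1000 * real k * L powr (1 / real k) \<le> 1000 * (\<epsilon> * ln L) * exp (2 * d)"
        using k(2) by (intro mult_mono) auto
      then show ?thesis by (auto simp: c\<^sub>2_def mult_ac)
    qed
    show ?case
    proof (intro allI impI)
      fix \<beta> :: real and m :: nat
      assume "\<beta> \<le> 1 \<and> \<beta> \<ge> 1 - real n powr (- c\<^sub>1)"
      then have "1 - real n powr (- 3) \<le> measure_pmf.prob (one_plus_beta n \<beta> m)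
          {x. gap n m x \<le> 1000 * real k * L powr (1 / real k)}"
        using elim(3) k(1) kappa delta unfolding L_def[symmetric] by force
      also have "\<dots> \<le> measure_pmf.prob (one_plus_beta n \<beta> m) {x. gap n m x \<le> c\<^sub>2 * ln L}"
        using sub[of m] by (intro measure_pmf.finite_measure_mono) auto
      finally show "1 - real n powr (- 3) \<le> measure_pmf.prob (one_plus_beta n \<beta> m)
          {x. gap n m x \<le> c\<^sub>2 * ln (ln n)}"
        by (simp add: L_def)
    qed
  qed
  moreover have "c\<^sub>2 > 0" using \<epsilon>(1) by (simp add: c\<^sub>2_def)
  ultimately show ?thesis by blast
qed

theorem theorem7p1:
  shows "(\<exists>N::nat. \<forall>n\<ge>N. \<forall>(k::nat) (\<beta>::real) (m::nat).
            1 \<le> k \<and> real k \<le> kappa * ln (ln (real n)) \<and>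
            0 \<le> \<beta> \<and> \<beta> \<le> 1 \<and>
            \<beta> \<ge> 1 - 2 powr (- 0.5 * ln (real n) powr ((real k - 1) / real k)) \<and>
            m \<ge> 1 \<longrightarrow>
            measure_pmf.prob (one_plus_beta n \<beta> m)
              {x. gap n m x \<le> 1000 * real k * ln (real n) powr (1 / real k)}
              \<ge> 1 - real n powr (- 3)) \<and>
         (\<exists>c::real. c > 0 \<and> (\<forall>c\<^sub>1::real. c\<^sub>1 > 0 \<longrightarrow>
           (\<exists>c\<^sub>2::real. c\<^sub>2 > 0 \<and> (\<exists>N::nat. \<forall>n\<ge>N. \<forall>(\<beta>::real) (m::nat).
              0 \<le> \<beta> \<and> \<beta> \<le> 1 \<and> \<beta> \<ge> 1 - real n powr (- c\<^sub>1) \<and> m \<ge> 1 \<longrightarrow>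
              measure_pmf.prob (one_plus_beta n \<beta> m)
                {x. gap n m x \<le> c\<^sub>2 * ln (ln (real n))}
                \<ge> 1 - real n powr (- c)))))"
proof (rule conjI)
  from gap_k obtain N where N: "\<And>(n::nat) (k::nat) (\<beta>::real) m. n \<ge> N \<Longrightarrow>
      1 \<le> k \<and> real k \<le> kappa * ln (ln n) \<and> \<beta> \<le> 1 \<and>
      \<beta> \<ge> 1 - 2 powr (- 0.5 * ln n powr ((real k - 1) / real k)) \<Longrightarrow>
      1 - real n powr (- 3) \<le> measure_pmf.prob (one_plus_beta n \<beta> m)
        {x. gap n m x \<le> 1000 * real k * ln n powr (1 / real k)}"
    unfolding eventually_sequentially by blast
  show "\<exists>N::nat. \<forall>n\<ge>N. \<forall>(k::nat) (\<beta>::real) (m::nat).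
            1 \<le> k \<and> real k \<le> kappa * ln (ln (real n)) \<and>
            0 \<le> \<beta> \<and> \<beta> \<le> 1 \<and>
            \<beta> \<ge> 1 - 2 powr (- 0.5 * ln (real n) powr ((real k - 1) / real k)) \<and>
            m \<ge> 1 \<longrightarrow>
            measure_pmf.prob (one_plus_beta n \<beta> m)
              {x. gap n m x \<le> 1000 * real k * ln (real n) powr (1 / real k)}
              \<ge> 1 - real n powr (- 3)"
    by (intro exI[of _ N] allI impI N) auto
next
  \<comment> \<open>The exponent 3 serves every \<open>c\<^sub>1\<close>, so \<open>c\<close> can be
    fixed before \<open>c\<^sub>1\<close>.\<close>
  have "\<exists>c\<^sub>2::real. c\<^sub>2 > 0 \<and> (\<exists>N::nat. \<forall>n\<ge>N. \<forall>(\<beta>::real) (m::nat).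
      0 \<le> \<beta> \<and> \<beta> \<le> 1 \<and> \<beta> \<ge> 1 - real n powr (- c\<^sub>1) \<and> m \<ge> 1 \<longrightarrow>
      measure_pmf.prob (one_plus_beta n \<beta> m) {x. gap n m x \<le> c\<^sub>2 * ln (ln (real n))}
        \<ge> 1 - real n powr (- 3))" if c\<^sub>1: "c\<^sub>1 > 0" for c\<^sub>1 :: real
  proof -
    from gap_loglog[OF c\<^sub>1] obtain c\<^sub>2 N where c\<^sub>2: "c\<^sub>2 > 0" and N: "\<And>(n::nat) (\<beta>::real) m. n \<ge> N \<Longrightarrow>
      \<beta> \<le> 1 \<and> \<beta> \<ge> 1 - real n powr (- c\<^sub>1) \<Longrightarrow>
      1 - real n powr (- 3) \<le> measure_pmf.prob (one_plus_beta n \<beta> m) {x. gap n m x \<le> c\<^sub>2 * ln (ln n)}"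
    unfolding eventually_sequentially by blast
    show ?thesis
      by (intro exI[of _ c\<^sub>2] conjI c\<^sub>2 exI[of _ N] allI impI N) auto
  qed
  then show "\<exists>c::real. c > 0 \<and> (\<forall>c\<^sub>1::real. c\<^sub>1 > 0 \<longrightarrow>
           (\<exists>c\<^sub>2::real. c\<^sub>2 > 0 \<and> (\<exists>N::nat. \<forall>n\<ge>N. \<forall>(\<beta>::real) (m::nat).
              0 \<le> \<beta> \<and> \<beta> \<le> 1 \<and> \<beta> \<ge> 1 - real n powr (- c\<^sub>1) \<and> m \<ge> 1 \<longrightarrow>
              measure_pmf.prob (one_plus_beta n \<beta> m)
                {x. gap n m x \<le> c\<^sub>2 * ln (ln (real n))}
                \<ge> 1 - real n powr (- c))))"
    by (intro exI[of _ "3::real"]) simp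
qed

end
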